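(* (a) Suppose that $X\sim E(\mu,K^{-1})$ and $X$ is conditionally increasing (CI). If $K$ has a zero entry then $X$ is Gaussian. (b) Suppose that $Y\sim\mathrm{TE}(\mu,K^{-1})$ and $Y$ is CI, and let $X=f(Y)\sim E(\mu,K^{-1})$, where $f=(f_1,\dots,f_d)$ are the strictly increasing functions associated with $Y$. If $K$ has a zero entry then $X$ is Gaussian.
   Context: A random vector $X=(X_1,\dots,X_d)$ has an elliptical distribution, written $X\sim E(\mu,\Sigma)$, if its characteristic function has the form $\boldsymbol t\mapsto \phi(\boldsymbol t^T\Sigma \boldsymbol t)\exp(i\mu^T \boldsymbol t)$ for some $\phi:[0,\infty)\to\mathbb{R}$, where $\mu\in\mathbb{R}^d$ and $\Sigma$ is a $d\times d$ symmetric matrix; $\phi$ is left implicit. Standing assumptions: $\Sigma$ is positive definite and, in the stochastic representation $X=\mu+\xi\,\Sigma^{1/2}U$ with $U$ uniform on the unit sphere of $\mathbb{R}^d$, $\xi\ge 0$ and $\xi$ independent of $U$, one has $0<\mathbb{E}\xi^2<\infty$. A random vector $Y$ has a transelliptical distribution, written $Y\sim \mathrm{TE}(\mu,\Sigma)$, if $f(Y):=(f_1(Y_1),\dots,f_d(Y_d))\sim E(\mu,\Sigma)$ for some fixed (deterministic) strictly increasing functions $f_1,\dots,f_d:\mathbb{R}\to\mathbb{R}$. Put $K=\Sigma^{-1}$ and $V=\{1,\dots,d\}$. A $d$-variate continuous random vector $W$ (with a density function) is conditionally increasing (CI) if for every $i\in V$ and $C\subseteq V\setminus\{i\}$ the conditional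 expectation $\mathbb{E}(h(W_i)\mid W_C)$ is an increasing function of $W_C$ (the subvector of $W$ with coordinates in $C$) for every increasing function $h:\mathbb{R}\to\mathbb{R}$ (for which it exists); here "increasing" means non-decreasing (coordinatewise, for functions of several variables). *)

theory Defs
  imports "HOL-Probability.Probability"
begin

text \<open>Random vectors are maps from a probability space into \<open>real ^ 'n\<close>; the coordinates are
  indexed by the finite type \<open>'n\<close>, so that \<open>d = CARD('n)\<close> and \<open>V = UNIV\<close>.\<close>

definition positive_definite :: "real ^ 'n ^ 'n \<Rightarrow> bool" where
  "positive_definite A \<longleftrightarrow> transpose A = A \<and> (\<forall>x. x \<noteq> 0 \<longrightarrow> 0 < x \<bullet> (A *v x))"

definition positive_semidefinite :: "real ^ 'n ^ 'n \<Rightarrow> bool" where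
  "positive_semidefinite A \<longleftrightarrow> transpose A = A \<and> (\<forall>x. 0 \<le> x \<bullet> (A *v x))"

definition char_vec :: "'a measure \<Rightarrow> ('a \<Rightarrow> real ^ 'n) \<Rightarrow> real ^ 'n \<Rightarrow> complex" where
  "char_vec M X t = (CLINT \<omega>|M. iexp (t \<bullet> X \<omega>))"

text \<open>Only the values of \<open>\<phi>\<close> on \<open>{0..}\<close> matter when \<open>\<Sigma>\<close> is positive semidefinite.\<close>

definition elliptical ::
  "'a measure \<Rightarrow> ('a \<Rightarrow> real ^ 'n) \<Rightarrow> real ^ 'n \<Rightarrow> real ^ 'n ^ 'n \<Rightarrow> bool" where
  "elliptical M X \<mu> \<Sigma> \<longleftrightarrow>
     X \<in> borel_measurable M \<and> transpose \<Sigma> = \<Sigma> \<and>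
     (\<exists>\<phi> :: real \<Rightarrow> real. \<forall>t.
        char_vec M X t = complex_of_real (\<phi> (t \<bullet> (\<Sigma> *v t))) * iexp (\<mu> \<bullet> t))"

text \<open>The uniform distribution on the unit sphere (normalised surface measure), as the law of the
  direction of a uniform point of the unit ball.\<close>

definition uniform_sphere :: "(real ^ 'n) measure" where
  "uniform_sphere = distr (uniform_measure lborel (ball 0 1)) borel sgn"

text \<open>\<open>X = \<mu> + \<xi> \<Sigma>\<^sup>1\<^sup>/\<^sup>2 U\<close> in distribution, where \<open>\<xi> \<ge> 0\<close> and \<open>U\<close> are independent,
  \<open>U\<close> is uniform on the unit sphere and \<open>\<xi>\<^sup>2\<close> has finite and nonzero mean. Here \<open>\<rho>\<close> is the law of \<open>\<xi>\<close>,
  the product measure is the joint law of \<open>(\<xi>, U)\<close>, and \<open>R\<close> is the positive definite square root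
  of \<open>\<Sigma>\<close>.\<close>

definition stochastic_representation ::
  "'a measure \<Rightarrow> ('a \<Rightarrow> real ^ 'n) \<Rightarrow> real ^ 'n \<Rightarrow> real ^ 'n ^ 'n \<Rightarrow> bool" where
  "stochastic_representation M X \<mu> \<Sigma> \<longleftrightarrow>
     (\<exists>(\<rho> :: real measure) R.
        prob_space \<rho> \<and> sets \<rho> = sets borel \<and> (AE r in \<rho>. 0 \<le> r) \<and>
        integrable \<rho> (\<lambda>r. r\<^sup>2) \<and> 0 < (LINT r|\<rho>. r\<^sup>2) \<and>
        positive_definite R \<and> R ** R = \<Sigma> \<and>
        distr M borel X =
          distr (\<rho> \<Otimes>\<^sub>M uniform_sphere) borel (\<lambda>(r, u). \<mu> + r *\<^sub>R (R *v u)))"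

definition coordinatewise :: "('n \<Rightarrow> real \<Rightarrow> real) \<Rightarrow> ('a \<Rightarrow> real ^ 'n) \<Rightarrow> 'a \<Rightarrow> real ^ 'n" where
  "coordinatewise f Y = (\<lambda>\<omega>. \<chi> i. f i (Y \<omega> $ i))"

definition transelliptical_via ::
  "('n \<Rightarrow> real \<Rightarrow> real) \<Rightarrow> 'a measure \<Rightarrow> ('a \<Rightarrow> real ^ 'n) \<Rightarrow> real ^ 'n \<Rightarrow> real ^ 'n ^ 'n \<Rightarrow> bool" where
  "transelliptical_via f M Y \<mu> \<Sigma> \<longleftrightarrow>
     Y \<in> borel_measurable M \<and> (\<forall>i. strict_mono (f i)) \<and> elliptical M (coordinatewise f Y) \<mu> \<Sigma>"

definition subvector :: "('a \<Rightarrow> real ^ 'n) \<Rightarrow> 'n set \<Rightarrow> 'a \<Rightarrow> 'n \<Rightarrow> real" where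
  "subvector W C \<omega> = (\<lambda>j\<in>C. W \<omega> $ j)"

definition sigma_of_subvector :: "'a measure \<Rightarrow> ('a \<Rightarrow> real ^ 'n) \<Rightarrow> 'n set \<Rightarrow> 'a measure" where
  "sigma_of_subvector M W C = vimage_algebra (space M) (subvector W C) (\<Pi>\<^sub>M j\<in>C. borel)"

text \<open>Conditional expectations are determined almost surely only: some version of
  \<open>E(h(W\<^sub>i) | W\<^sub>C)\<close> has to be a coordinatewise non-decreasing function of \<open>W\<^sub>C\<close>. The order used by
  \<open>mono_on\<close> is the pointwise one on \<open>'n \<Rightarrow> real\<close>, which on \<open>C \<rightarrow>\<^sub>E UNIV\<close> only compares the
  coordinates in \<open>C\<close>.\<close>

definition conditionally_increasing :: "'a measure \<Rightarrow> ('a \<Rightarrow> real ^ 'n) \<Rightarrow> bool" where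
  "conditionally_increasing M W \<longleftrightarrow>
     (\<exists>p. distributed M lborel W p) \<and>
     (\<forall>i. \<forall>C \<subseteq> UNIV - {i}. \<forall>h :: real \<Rightarrow> real.
        mono h \<and> integrable M (\<lambda>\<omega>. h (W \<omega> $ i)) \<longrightarrow>
        (\<exists>g :: ('n \<Rightarrow> real) \<Rightarrow> real. mono_on (C \<rightarrow>\<^sub>E UNIV) g \<and>
           (AE \<omega> in M. real_cond_exp M (sigma_of_subvector M W C) (\<lambda>\<omega>. h (W \<omega> $ i)) \<omega>
                        = g (subvector W C \<omega>))))"

definition gaussian_vector :: "'a measure \<Rightarrow> ('a \<Rightarrow> real ^ 'n) \<Rightarrow> bool" where
  "gaussian_vector M X \<longleftrightarrow>
     X \<in> borel_measurable M \<and>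
     (\<exists>m S. positive_semidefinite S \<and>
        (\<forall>t. char_vec M X t = exp (\<i> * complex_of_real (m \<bullet> t) - complex_of_real (t \<bullet> (S *v t)) / 2)))"

end

theory Submission
  imports Defs
begin

text \<open>
  Why the theorem holds. Part (a) is part (b) for the identity functions, so only the
  transelliptical case is treated. Let \<open>R\<close> be the positive definite square root of \<open>\<Sigma>\<close> and write
  \<open>X = \<mu> + R Z\<close>, where \<open>Z\<close> has a spherically symmetric law. Put \<open>d\<^sub>k = R\<^sup>-\<^sup>1 e\<^sub>k\<close>. Moving \<open>Z\<close> along
  \<open>d\<^sub>k\<close> moves only the \<open>k\<close>-th coordinate of \<open>X\<close>, and \<open>d\<^sub>i \<bullet> d\<^sub>j\<close> is the entry \<open>K\<^sub>i\<^sub>j\<close>. Fix a zero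
  entry; then \<open>i \<noteq> j\<close>, as \<open>d\<^sub>i \<noteq> 0\<close>, and \<open>d\<^sub>i\<close> is orthogonal to \<open>d\<^sub>j\<close>. Conditioning on all coordinates of \<open>X\<close>
  except the \<open>i\<close>-th is conditioning on the projection of \<open>Z\<close> onto the hyperplane orthogonal to \<open>d\<^sub>i\<close>.

  \<^item> The reflection of \<open>Z\<close> in the hyperplane orthogonal to \<open>d\<^sub>j\<close> keeps the law of \<open>Z\<close> and, because
    \<open>K\<^sub>i\<^sub>j = 0\<close>, keeps \<open>X\<^sub>i\<close>; on \<open>X\<close> it only reflects the \<open>j\<close>-th coordinate about a centre that depends
    on the coordinates other than \<open>i\<close> and \<open>j\<close>. Hence \<open>E(h(X\<^sub>i) | rest)\<close> is an even function of the
    \<open>j\<close>-th coordinate about that centre. For increasing \<open>h\<close> it is also increasing, and a function that is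
    both even and increasing is constant. So the conditional expectation ignores the \<open>j\<close>-th
    coordinate (\<open>increasing_cond_exp_ignores_coordinate\<close>).

  \<^item> The functions \<open>s y\<close>, \<open>s y + cos (s y)\<close> and \<open>s y + sin (s y)\<close> are increasing, and \<open>X\<^sub>i\<close>
    differs from a multiple of \<open>d\<^sub>i \<bullet> Z\<close> by a regression function that ignores \<open>X\<^sub>j\<close> as well. So the conditional
    expectation \<open>\<Psi>\<close> of \<open>cos (s (d\<^sub>i \<bullet> Z))\<close> ignores the \<open>j\<close>-th coordinate. As \<open>d\<^sub>i \<bullet> Z\<close> is unchanged by
    every reflection that fixes \<open>d\<^sub>i\<close>, so is \<open>\<Psi>\<close>. Thus \<open>\<Psi>\<close> is invariant under translations along
    \<open>d\<^sub>j\<close> and, after reflecting, along every direction: it is almost surely constant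
    (\<open>constant_if_invariant_direction\<close>).

  \<^item> Consequently \<open>E[cos (s (d\<^sub>i \<bullet> Z)) cos (q (d\<^sub>j \<bullet> Z))]\<close> factorises (\<open>cos_product\<close>), which says that the
    radial characteristic function \<open>\<phi>\<close> satisfies \<open>\<phi>(p + q) = \<phi>(p) \<phi>(q)\<close>. Being bounded and continuous
    at the origin, \<open>\<phi>\<close> is an exponential, and \<open>X\<close> is Gaussian.

  Two measure-theoretic points need care. A monotone function of several variables need not be Borel
  measurable; it is replaced by a Borel function that agrees with it outside a Lebesgue null set
  (\<open>AE_sup_below_eq_inf_above\<close>). And \<open>Z\<close> need not have a density; but its projection along a direction
  has the same null sets as Lebesgue measure on an open cylinder
  (\<open>AE_spherical_law_cylinder_iff\<close>), which is all that the translation argument uses.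
\<close>

section \<open>Lebesgue measure, null sets and orthogonal maps\<close>

lemma AE_lborel_iff_negligible:
  "(AE x in lborel. P x) \<longleftrightarrow> negligible {x. \<not> P x}" for P :: "'a::euclidean_space \<Rightarrow> bool"
  by (subst AE_completion_iff[symmetric])
    (simp add: completion.AE_iff_null_sets negligible_iff_null_sets)

lemma emeasure_lborel_unit_ball:
  "emeasure lborel (ball (0::'a::euclidean_space) 1) \<noteq> 0"
  "emeasure lborel (ball (0::'a::euclidean_space) 1) < \<top>"
proof -
  show "emeasure lborel (ball (0::'a) 1) \<noteq> 0"
    using open_not_negligible[of "ball (0::'a) 1"]
    by (auto simp: negligible_iff_null_sets null_sets_completion_iff null_sets_def)
  show "emeasure lborel (ball (0::'a) 1) < \<top>"
    using emeasure_lborel_ball_finite[of "0::'a" 1] by (simp add: less_top)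
qed

text \<open>Uniqueness of translation-invariant measures, by a double integral: for \<open>\<nu>\<close> the image of Lebesgue
  measure \<open>\<lambda>\<close> one gets \<open>\<lambda>(A) \<nu>(B) = \<lambda>(B) \<nu>(A)\<close>, and on the unit ball \<open>\<nu>\<close> and \<open>\<lambda>\<close> agree.\<close>
lemma lborel_orthogonal_transformation:
  fixes f :: "'a::euclidean_space \<Rightarrow> 'a"
  assumes f: "orthogonal_transformation f"
  shows "distr lborel borel f = lborel"
proof -
  have lin: "linear f"
    using f by (rule orthogonal_transformation_linear)
  have [measurable]: "f \<in> borel_measurable borel"
    using lin by (intro borel_measurable_continuous_onI linear_continuous_on linear_conv_bounded_linear[THEN iffD1])
  obtain g where g: "orthogonal_transformation g" "\<And>x. f (g x) = x" "\<And>x. g (f x) = x"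
    using f orthogonal_transformation_inv orthogonal_transformation_surj surj_f_inv_f
      orthogonal_transformation_inj inv_f_f by metis
  define \<nu> :: "'a measure" where "\<nu> = distr lborel borel f"
  have [measurable_cong, simp]: "sets \<nu> = sets borel" and [simp]: "space \<nu> = UNIV"
    by (auto simp: \<nu>_def)
  have shift_lborel: "(\<integral>\<^sup>+x. h (x + c) \<partial>lborel) = (\<integral>\<^sup>+x. h x \<partial>lborel)"
    if [measurable]: "h \<in> borel_measurable borel" for h :: "'a \<Rightarrow> ennreal" and c
    by (subst (2) lborel_distr_plus[of c, symmetric])
      (simp add: nn_integral_distr add.commute)
  have refl_lborel: "(\<integral>\<^sup>+x. h (c - x) \<partial>lborel) = (\<integral>\<^sup>+x. h x \<partial>lborel)"
    if [measurable]: "h \<in> borel_measurable borel" for h :: "'a \<Rightarrow> ennreal" and c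
    by (subst (2) lborel_affine[of "-1" c])
      (simp_all add: nn_integral_density nn_integral_distr)
  have nu_int: "(\<integral>\<^sup>+x. h x \<partial>\<nu>) = (\<integral>\<^sup>+x. h (f x) \<partial>lborel)"
    if [measurable]: "h \<in> borel_measurable borel" for h :: "'a \<Rightarrow> ennreal"
    by (simp add: \<nu>_def nn_integral_distr)
  have shift_nu: "(\<integral>\<^sup>+x. h (x + c) \<partial>\<nu>) = (\<integral>\<^sup>+x. h x \<partial>\<nu>)"
    if [measurable]: "h \<in> borel_measurable borel" for h :: "'a \<Rightarrow> ennreal" and c
    using shift_lborel[of "\<lambda>x. h (f x)" "g c"] lin
    by (simp add: nu_int linear_add g)
  have refl_nu: "(\<integral>\<^sup>+x. h (c - x) \<partial>\<nu>) = (\<integral>\<^sup>+x. h x \<partial>\<nu>)"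
    if [measurable]: "h \<in> borel_measurable borel" for h :: "'a \<Rightarrow> ennreal" and c
    using refl_lborel[of "\<lambda>x. h (f x)" "g c"] lin
    by (simp add: nu_int linear_diff g)
  have sf: "sigma_finite_measure \<nu>"
  proof
    show "\<exists>A. countable A \<and> A \<subseteq> sets \<nu> \<and> \<Union>A = space \<nu> \<and> (\<forall>a\<in>A. emeasure \<nu> a \<noteq> \<infinity>)"
    proof (intro exI conjI)
      show "\<Union>(range (\<lambda>n::nat. ball (0::'a) n)) = space \<nu>"
        using reals_Archimedean2 by auto
      have "f -` ball 0 r = ball 0 r" for r
        using orthogonal_transformation_norm[OF f] by auto
      then show "\<forall>a\<in>range (\<lambda>n::nat. ball (0::'a) n). emeasure \<nu> a \<noteq> \<infinity>"
        using emeasure_lborel_ball_finite[of "0::'a"] by (auto simp: \<nu>_def emeasure_distr less_top[symmetric])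
    qed auto
  qed
  interpret L: sigma_finite_measure "lborel :: 'a measure" by (rule sigma_finite_lborel)
  interpret N: sigma_finite_measure \<nu> by (rule sf)
  interpret P: pair_sigma_finite "lborel :: 'a measure" \<nu> ..
  have prod: "emeasure lborel A * emeasure \<nu> B = emeasure lborel B * emeasure \<nu> A"
    if [measurable]: "A \<in> sets borel" "B \<in> sets borel" for A B
  proof -
    have "emeasure lborel A * emeasure \<nu> B
        = (\<integral>\<^sup>+x. indicator A x * (\<integral>\<^sup>+y. indicator B y \<partial>\<nu>) \<partial>lborel)"
      by (simp add: nn_integral_multc)
    also have "\<dots> = (\<integral>\<^sup>+x. indicator A x * (\<integral>\<^sup>+y. indicator B (y + x) \<partial>\<nu>) \<partial>lborel)"
      by (simp add: shift_nu[of "indicator B"])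
    also have "\<dots> = (\<integral>\<^sup>+x. (\<integral>\<^sup>+y. indicator A x * indicator B (y + x) \<partial>\<nu>) \<partial>lborel)"
      by (simp add: nn_integral_cmult)
    also have "\<dots> = (\<integral>\<^sup>+y. (\<integral>\<^sup>+x. indicator A x * indicator B (y + x) \<partial>lborel) \<partial>\<nu>)"
      by (rule P.Fubini'[symmetric]) simp
    also have "\<dots> = (\<integral>\<^sup>+y. (\<integral>\<^sup>+x. indicator A (x - y) * indicator B x \<partial>lborel) \<partial>\<nu>)"
    proof (rule nn_integral_cong)
      fix y
      show "(\<integral>\<^sup>+x. indicator A x * indicator B (y + x) \<partial>lborel)
          = (\<integral>\<^sup>+x. indicator A (x - y) * indicator B x \<partial>lborel)"
        using shift_lborel[of "\<lambda>x. indicator A (x - y) * indicator B x" y]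
        by (simp add: add.commute[of y])
    qed
    also have "\<dots> = (\<integral>\<^sup>+x. (\<integral>\<^sup>+y. indicator A (x - y) * indicator B x \<partial>\<nu>) \<partial>lborel)"
      by (rule P.Fubini') simp
    also have "\<dots> = (\<integral>\<^sup>+x. (\<integral>\<^sup>+y. indicator A (x - y) \<partial>\<nu>) * indicator B x \<partial>lborel)"
      by (simp add: nn_integral_multc)
    also have "\<dots> = emeasure lborel B * emeasure \<nu> A"
      by (simp add: refl_nu[of "indicator A"] nn_integral_multc mult.commute[of _ "emeasure \<nu> A"] nn_integral_cmult)
    finally show ?thesis .
  qed
  have ball: "emeasure \<nu> (ball 0 1) = emeasure lborel (ball (0::'a) 1)"
  proof -
    have "f -` ball 0 1 = ball 0 1"
      using orthogonal_transformation_norm[OF f] by auto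
    then show ?thesis by (simp add: \<nu>_def emeasure_distr)
  qed
  show ?thesis
  proof (rule measure_eqI)
    fix A assume "A \<in> sets (distr lborel borel f)"
    then have [measurable]: "A \<in> sets borel" by simp
    have "emeasure lborel (ball (0::'a) 1) * emeasure lborel A = emeasure lborel (ball (0::'a) 1) * emeasure \<nu> A"
      using prod[of A "ball 0 1"] by (simp add: ball mult.commute)
    then show "emeasure (distr lborel borel f) A = emeasure lborel A"
      using emeasure_lborel_unit_ball[where 'a='a] by (auto simp: \<nu>_def ennreal_mult_cancel_left)
  qed simp
qed

text \<open>The reflection in the hyperplane orthogonal to \<open>v\<close>. Division by zero makes it the identity for
  \<open>v = 0\<close>, so that no case distinction on \<open>v\<close> is needed below.\<close>
definition mirror :: "'a::real_inner \<Rightarrow> 'a \<Rightarrow> 'a" where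
  "mirror v z = z - (2 * (v \<bullet> z) / (v \<bullet> v)) *\<^sub>R v"

lemma orthogonal_transformation_mirror: "orthogonal_transformation (mirror v)"
proof -
  have "linear (mirror v)"
    by (rule linearI) (simp_all add: mirror_def inner_add_right algebra_simps add_divide_distrib)
  moreover have "mirror v x \<bullet> mirror v y = x \<bullet> y" for x y
    by (cases "v = 0")
      (simp_all add: mirror_def inner_diff_left inner_diff_right inner_commute divide_simps)
  ultimately show ?thesis
    by (simp add: orthogonal_transformation_def)
qed

lemma mirror_mirror: "mirror v (mirror v z) = z"
  by (cases "v = 0") (simp_all add: mirror_def inner_diff_right)

lemma mirror_add: "mirror v (x + y) = mirror v x + mirror v y"
  using orthogonal_transformation_linear[OF orthogonal_transformation_mirror] by (rule linear_add)

lemma mirror_orthogonal: "v \<bullet> x = 0 \<Longrightarrow> mirror v x = x"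
  by (simp add: mirror_def)

text \<open>Any two vectors of equal length are exchanged by a reflection; it fixes whatever is orthogonal
  to their difference.\<close>
lemma mirror_diff_swap:
  assumes "norm x = norm y" shows "mirror (x - y) x = y"
proof (cases "x = y")
  case False
  have "y \<bullet> y = x \<bullet> x" using assms by (simp add: norm_eq)
  then have "2 * ((x - y) \<bullet> x) = (x - y) \<bullet> (x - y)"
    by (simp add: inner_diff_left inner_diff_right inner_commute)
  moreover have "(x - y) \<bullet> (x - y) \<noteq> 0" using False by simp
  ultimately show ?thesis by (simp add: mirror_def)
qed (simp add: mirror_def)

lemma inner_mirror: "mirror v x \<bullet> mirror v y = x \<bullet> y"
  using orthogonal_transformation_mirror orthogonal_transformation_def by blast

lemma measurable_mirror[measurable]: "mirror (v :: 'a::euclidean_space) \<in> borel_measurable borel"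
  unfolding mirror_def by measurable

lemma AE_lborel_mirror:
  assumes "AE x in lborel. P x" shows "AE x in lborel. P (mirror (v::'a::euclidean_space) x)"
  using assms
  by (subst (asm) lborel_orthogonal_transformation[OF orthogonal_transformation_mirror[of v], symmetric])
    (auto dest: AE_distrD[rotated])

lemma AE_lborel_shift:
  assumes "AE x in lborel. P x" shows "AE x in lborel. P (x + c :: 'a::euclidean_space)"
  using assms
  by (subst (asm) lborel_distr_plus[of c, symmetric])
    (auto dest: AE_distrD[rotated] simp: add.commute)

lemma AE_lborel_ex:
  assumes "AE x in lborel. Q x" "open S" "x0 \<in> S"
  shows "\<exists>x\<in>S. Q (x::'a::euclidean_space)"
proof (rule ccontr)
  assume "\<not> (\<exists>x\<in>S. Q x)"
  then have "negligible S"
    using assms(1) by (auto simp: AE_lborel_iff_negligible intro: negligible_subset)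
  then show False using open_not_negligible[OF assms(2)] assms(3) by blast
qed

section \<open>Slices of spheres along a direction\<close>

definition perp :: "'a::real_inner \<Rightarrow> 'a \<Rightarrow> 'a" where
  "perp a z = z - (a \<bullet> z) *\<^sub>R a"

lemma perp_add: "norm a = 1 \<Longrightarrow> perp a (z + t *\<^sub>R a) = perp a z"
  by (simp add: perp_def inner_add_right dot_square_norm algebra_simps)

lemma inner_perp: "norm a = 1 \<Longrightarrow> a \<bullet> perp a z = 0"
  by (simp add: perp_def inner_diff_right dot_square_norm)

lemma perp_scaleR: "perp a (c *\<^sub>R z) = c *\<^sub>R perp a z"
  by (simp add: perp_def algebra_simps)

lemma norm_perp:
  assumes "norm a = 1" shows "(norm (perp a z))\<^sup>2 = (norm z)\<^sup>2 - (a \<bullet> z)\<^sup>2"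
  using assms unfolding power2_norm_eq_inner perp_def
  by (simp add: inner_diff_left inner_diff_right power2_eq_square inner_commute norm_eq_1)

lemma perp_perp: "norm a = 1 \<Longrightarrow> perp a (perp a z) = perp a z"
  by (simp add: perp_def inner_diff_right dot_square_norm)

lemma differentiable_at_ln: "0 < x \<Longrightarrow> ln differentiable at (x::real)"
  using DERIV_ln real_differentiable_def by blast

lemma differentiable_at_sqrt: "0 < x \<Longrightarrow> sqrt differentiable at (x::real)"
  using DERIV_real_sqrt real_differentiable_def by blast

lemma differentiable_at_exp: "exp differentiable at (x::real)"
  using DERIV_exp real_differentiable_def by blast

text \<open>The projection of a uniform point of a sphere of radius \<open>r\<close> onto the hyperplane orthogonal to \<open>a\<close>
  has the same null sets as Lebesgue measure on the ball of radius \<open>r\<close> in that hyperplane. Both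
  directions follow from differentiable maps sending null sets to null sets. To stay in one space,
  subsets of the hyperplane are represented by sets \<open>N\<close> invariant along \<open>a\<close>, and the spare
  coordinate along \<open>a\<close> records the length of the point \<open>b\<close> of the unit ball: \<open>ln (- ln (norm b))\<close>
  maps the lengths in \<open>{0<..<1}\<close> bijectively onto the real line.\<close>
lemma negligible_sphere_slice_iff:
  fixes a :: "'a::euclidean_space"
  assumes a: "norm a = 1" and r: "0 < r" and N: "\<And>z t. z + t *\<^sub>R a \<in> N \<longleftrightarrow> z \<in> N"
  shows "negligible {b \<in> ball 0 1. r *\<^sub>R sgn b \<in> N} \<longleftrightarrow> negligible {z \<in> N. norm (perp a z) < r}"
    (is "negligible ?B \<longleftrightarrow> negligible ?Z")
proof
  have perpN: "perp a z + t *\<^sub>R a \<in> N \<longleftrightarrow> z \<in> N" for z t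
    using N[of z "t - a \<bullet> z"] by (simp add: perp_def algebra_simps)
  assume neg: "negligible ?B"
  \<comment> \<open>\<open>F\<close> sends \<open>b\<close> to the projection of \<open>r *\<^sub>R sgn b\<close>, lifted to a height that encodes \<open>norm b\<close>.\<close>
  define F where "F b = r *\<^sub>R perp a (b /\<^sub>R norm b) + ln (- ln (norm b)) *\<^sub>R a" for b
  have "negligible (F ` (?B - {0}))"
  proof (rule negligible_differentiable_image_negligible)
    show "negligible (?B - {0})"
      using neg by (rule negligible_diff)
    have "F differentiable at b" if "b \<noteq> 0" "norm b < 1" for b
      unfolding F_def perp_def using that
      by (intro derivative_intros differentiable_norm_at differentiable_at_ln
          differentiable_compose[of ln "\<lambda>b. - ln (norm b)"] differentiable_compose[of ln norm]) auto
    then show "F differentiable_on (?B - {0})"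
      by (auto simp: differentiable_on_def intro: differentiable_at_withinI)
  qed auto
  moreover have "?Z \<subseteq> F ` (?B - {0})"
  proof
    fix z assume z: "z \<in> ?Z"
    define w where "w = perp a z /\<^sub>R r + sqrt (1 - (norm (perp a z))\<^sup>2 / r\<^sup>2) *\<^sub>R a"
    have le: "(norm (perp a z))\<^sup>2 / r\<^sup>2 \<le> 1"
      using z r by (simp add: power_mono)
    have aw: "a \<bullet> w = sqrt (1 - (norm (perp a z))\<^sup>2 / r\<^sup>2)"
      using a by (simp add: w_def inner_add_right inner_perp dot_square_norm)
    have pw: "perp a w = perp a z /\<^sub>R r"
      using a by (simp add: w_def perp_add perp_scaleR perp_perp)
    have "(norm (perp a w))\<^sup>2 = (norm (perp a z))\<^sup>2 / r\<^sup>2"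
      using r by (simp add: pw power_mult_distrib power_inverse divide_inverse)
    then have "(norm w)\<^sup>2 = 1"
      using norm_perp[OF a, of w] real_sqrt_pow2[of "1 - (norm (perp a z))\<^sup>2 / r\<^sup>2"] le unfolding aw
      by linarith
    then have nw: "norm w = 1"
      by (simp add: power2_eq_1_iff) (use norm_ge_zero[of w] in linarith)
    define b where "b = exp (- exp (a \<bullet> z)) *\<^sub>R w"
    have nb: "norm b = exp (- exp (a \<bullet> z))"
      by (simp add: b_def nw)
    have sb: "b /\<^sub>R norm b = w"
      by (simp add: nb) (simp add: b_def)
    have "F b = perp a z + (a \<bullet> z) *\<^sub>R a"
      unfolding F_def sb using r by (simp add: pw nb)
    then have "F b = z" by (simp add: perp_def)
    moreover have "b \<noteq> 0" using nb by auto
    moreover have "norm b < 1" by (simp add: nb)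
    moreover have "r *\<^sub>R sgn b \<in> N"
    proof -
      have "perp a (r *\<^sub>R sgn b) = perp a z"
        using r by (simp add: sgn_div_norm sb perp_scaleR pw)
      then show ?thesis
        using perpN[of z 0] perpN[of "r *\<^sub>R sgn b" 0] z by simp
    qed
    ultimately show "z \<in> F ` (?B - {0})" by force
  qed
  ultimately show "negligible ?Z"
    by (rule negligible_subset)
next
  have perpN: "perp a z + t *\<^sub>R a \<in> N \<longleftrightarrow> z \<in> N" for z t
    using N[of z "t - a \<bullet> z"] by (simp add: perp_def algebra_simps)
  assume neg: "negligible ?Z"
  \<comment> \<open>For \<open>s = 1\<close> and \<open>s = - 1\<close> these are the inverses of \<open>F\<close> on the two open half balls; the equator that they
    miss is negligible.\<close>
  define H where "H s z = exp (- exp (a \<bullet> z)) *\<^sub>R (perp a z /\<^sub>R r + (s * sqrt (1 - (norm (perp a z))\<^sup>2 / r\<^sup>2)) *\<^sub>R a)"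
    for s :: real and z
  have "negligible (H s ` ?Z)" for s
  proof (rule negligible_differentiable_image_negligible[OF _ neg])
    have "H s differentiable at z" if "norm (perp a z) < r" for z
    proof -
      have "(norm (perp a z))\<^sup>2 < r\<^sup>2"
        using that by (simp add: power_strict_mono)
      then have "0 < 1 - (norm (perp a z))\<^sup>2 / r\<^sup>2" using r by simp
      then have pos: "0 < 1 - (perp a z \<bullet> perp a z) / r\<^sup>2"
        by (simp add: power2_norm_eq_inner)
      have perp_diff: "perp a differentiable at z"
        unfolding perp_def by (intro derivative_intros differentiable_inner differentiable_ident)
      then have "(\<lambda>z. 1 - (perp a z \<bullet> perp a z) * inverse (r\<^sup>2)) differentiable at z"
        by (intro differentiable_diff differentiable_mult differentiable_const differentiable_inner)
      then have "(\<lambda>z. sqrt (1 - (perp a z \<bullet> perp a z) * inverse (r\<^sup>2))) differentiable at z"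
        using pos by (intro differentiable_compose[of sqrt "\<lambda>z. 1 - (perp a z \<bullet> perp a z) * inverse (r\<^sup>2)"]
            differentiable_at_sqrt) (simp_all add: divide_inverse)
      moreover have "(\<lambda>z. exp (- exp (a \<bullet> z))) differentiable at z"
        by (intro differentiable_compose[of exp "\<lambda>z. - exp (a \<bullet> z)"] differentiable_compose[of exp "\<lambda>z. a \<bullet> z"]
            differentiable_at_exp differentiable_minus differentiable_inner differentiable_const differentiable_ident)
      ultimately show ?thesis
        using perp_diff unfolding H_def power2_norm_eq_inner divide_inverse
        by (intro differentiable_scaleR differentiable_add differentiable_mult differentiable_const)
    qed
    then show "H s differentiable_on ?Z"
      by (auto simp: differentiable_on_def intro: differentiable_at_withinI)
  qed auto
  then have "negligible (H 1 ` ?Z \<union> H (-1) ` ?Z \<union> {b. a \<bullet> b = 0})"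
    using a by (auto intro!: negligible_Un negligible_hyperplane)
  moreover have "?B \<subseteq> H 1 ` ?Z \<union> H (-1) ` ?Z \<union> {b. a \<bullet> b = 0}"
  proof
    fix b assume b: "b \<in> ?B"
    have "b \<in> H (sgn (a \<bullet> b)) ` ?Z" if nz: "a \<bullet> b \<noteq> 0"
    proof
      have [simp]: "b \<noteq> 0" using nz by auto
      define u where "u = sgn b"
      have nu: "norm u = 1" by (simp add: u_def norm_sgn)
      have ua: "a \<bullet> u = inverse (norm b) * (a \<bullet> b)"
        by (simp add: u_def sgn_div_norm)
      have au: "sgn (a \<bullet> b) = sgn (a \<bullet> u)" "a \<bullet> u \<noteq> 0"
        using nz by (simp_all add: ua sgn_mult)
      define z where "z = r *\<^sub>R perp a u + ln (- ln (norm b)) *\<^sub>R a"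
      have az: "a \<bullet> z = ln (- ln (norm b))"
        using a by (simp add: z_def inner_add_right inner_perp dot_square_norm)
      have ez: "exp (- exp (a \<bullet> z)) = norm b"
        using b unfolding az by (simp add: ln_less_zero)
      have pz: "perp a z = r *\<^sub>R perp a u"
        using a by (simp add: z_def perp_add perp_scaleR perp_perp)
      have np: "(norm (perp a u))\<^sup>2 = 1 - (a \<bullet> u)\<^sup>2"
        using norm_perp[OF a, of u] nu by simp
      have "sgn (a \<bullet> u) * sqrt (1 - (norm (perp a z))\<^sup>2 / r\<^sup>2) = a \<bullet> u"
        using r by (simp add: pz power_mult_distrib np) (simp add: sgn_if)
      then have "H (sgn (a \<bullet> b)) z = norm b *\<^sub>R (perp a u + (a \<bullet> u) *\<^sub>R a)"
        unfolding H_def ez au(1) using r by (simp add: pz)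
      then show "b = H (sgn (a \<bullet> b)) z"
        by (simp add: perp_def u_def sgn_div_norm)
      have "perp a (r *\<^sub>R u) = perp a z" by (simp add: pz perp_scaleR)
      then have "z \<in> N"
        using perpN[of z 0] perpN[of "r *\<^sub>R u" 0] b by (simp add: u_def)
      moreover have "norm (perp a z) < r"
      proof -
        have "(norm (perp a u))\<^sup>2 < 1" using np au(2) by simp
        then have "norm (perp a u) < 1" by (simp add: power2_less_1_iff abs_square_less_1)
        then show ?thesis using r by (simp add: pz)
      qed
      ultimately show "z \<in> ?Z" by simp
    qed
    then show "b \<in> H 1 ` ?Z \<union> H (-1) ` ?Z \<union> {b. a \<bullet> b = 0}"
      by (cases "a \<bullet> b" "0::real" rule: linorder_cases) auto
  qed
  ultimately show "negligible ?B"
    by (rule negligible_subset)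
qed

section \<open>Spherically symmetric laws\<close>

text \<open>The law of \<open>\<xi> U\<close>, where \<open>\<xi>\<close> has law \<open>\<rho>\<close> and \<open>U\<close> is an independent uniform direction.\<close>
definition spherical_law :: "real measure \<Rightarrow> 'a::euclidean_space measure" where
  "spherical_law \<rho> = distr (\<rho> \<Otimes>\<^sub>M uniform_measure lborel (ball 0 1)) borel (\<lambda>(r, b). r *\<^sub>R sgn b)"

lemma prob_space_uniform_ball: "prob_space (uniform_measure lborel (ball (0::'a::euclidean_space) 1))"
  using emeasure_lborel_unit_ball[where 'a='a] by (intro prob_space_uniform_measure) auto

locale positive_radius = prob_space \<rho> for \<rho> :: "real measure" +
  assumes sets_radius[measurable_cong, simp]: "sets \<rho> = sets borel"
    and radius_pos: "AE r in \<rho>. 0 < r"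
begin

lemma space_radius[simp]: "space \<rho> = UNIV"
  using sets_eq_imp_space_eq[OF sets_radius] by simp

lemma pair_ball: "pair_sigma_finite \<rho> (uniform_measure lborel (ball (0::'a::euclidean_space) 1))"
proof -
  interpret B: prob_space "uniform_measure lborel (ball (0::'a) 1)" by (rule prob_space_uniform_ball)
  show ?thesis ..
qed

lemma sets_spherical_law[simp, measurable_cong]: "sets (spherical_law \<rho>) = sets borel"
  and space_spherical_law[simp]: "space (spherical_law \<rho>) = UNIV"
  by (simp_all add: spherical_law_def)

lemma prob_space_spherical_law: "prob_space (spherical_law \<rho> :: 'a::euclidean_space measure)"
proof -
  interpret B: prob_space "uniform_measure lborel (ball (0::'a) 1)" by (rule prob_space_uniform_ball)
  interpret P: pair_prob_space \<rho> "uniform_measure lborel (ball (0::'a) 1)" ..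
  show ?thesis
    unfolding spherical_law_def by (rule P.prob_space_distr) measurable
qed

lemma AE_spherical_law_iff:
  assumes [measurable]: "Measurable.pred borel P"
  shows "(AE z in spherical_law \<rho> :: 'a::euclidean_space measure. P z)
    \<longleftrightarrow> (AE r in \<rho>. negligible {b \<in> ball 0 1. r *\<^sub>R sgn b \<in> {z. \<not> P z}})"
proof -
  interpret P: pair_sigma_finite \<rho> "uniform_measure lborel (ball (0::'a) 1)" by (rule pair_ball)
  have "(AE z in spherical_law \<rho>. P z)
      \<longleftrightarrow> (AE x in \<rho> \<Otimes>\<^sub>M uniform_measure lborel (ball (0::'a) 1). P (fst x *\<^sub>R sgn (snd x)))"
    unfolding spherical_law_def by (subst AE_distr_iff) (auto simp: case_prod_unfold)
  also have "\<dots> \<longleftrightarrow> (AE r in \<rho>. AE b in uniform_measure lborel (ball (0::'a) 1). P (r *\<^sub>R sgn b))"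
    by (rule P.AE_pair_iff[symmetric]) measurable
  also have "\<dots> \<longleftrightarrow> (AE r in \<rho>. AE b in lborel. b \<in> ball (0::'a) 1 \<longrightarrow> P (r *\<^sub>R sgn b))"
    using emeasure_lborel_unit_ball by (subst AE_uniform_measure) auto
  finally show ?thesis
    by (simp add: AE_lborel_iff_negligible)
qed

lemma spherical_law_mirror:
  "distr (spherical_law \<rho>) borel (mirror v) = (spherical_law \<rho> :: 'a::euclidean_space measure)"
proof -
  let ?U = "uniform_measure lborel (ball (0::'a) 1)"
  have lin: "linear (mirror v)" and nrm: "norm (mirror v x) = norm x" for x :: 'a
    using orthogonal_transformation_mirror[of v] orthogonal_transformation_linear orthogonal_transformation_norm
    by blast+
  have U: "distr ?U borel (mirror v) = ?U"
  proof (rule measure_eqI)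
    fix A assume "A \<in> sets (distr ?U borel (mirror v))"
    then have [measurable]: "A \<in> sets borel" by simp
    have "emeasure lborel (ball 0 1 \<inter> mirror v -` A) = emeasure (distr lborel borel (mirror v)) (ball 0 1 \<inter> A)"
      by (subst emeasure_distr) (auto intro!: arg_cong[where f="emeasure lborel"] simp: nrm)
    then have "emeasure lborel (ball 0 1 \<inter> mirror v -` A) = emeasure lborel (ball 0 1 \<inter> A)"
      by (simp add: lborel_orthogonal_transformation[OF orthogonal_transformation_mirror])
    moreover have "mirror v -` A \<in> sets borel"
      using measurable_sets[OF measurable_mirror[of v], of A] by simp
    ultimately show "emeasure (distr ?U borel (mirror v)) A = emeasure ?U A"
      by (simp add: emeasure_distr)
  qed simp
  interpret B: prob_space ?U by (rule prob_space_uniform_ball)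
  have D: "distr (\<rho> \<Otimes>\<^sub>M ?U) (\<rho> \<Otimes>\<^sub>M borel) (\<lambda>(r, b). (r, mirror v b)) = \<rho> \<Otimes>\<^sub>M ?U"
    using pair_measure_distr[of "\<lambda>r. r" \<rho> \<rho> "mirror v" ?U borel]
    by (simp add: U distr_id2 B.sigma_finite_measure_axioms)
  have eq: "mirror v (r *\<^sub>R sgn b) = r *\<^sub>R sgn (mirror v b)" for r b
    using lin by (simp add: sgn_div_norm linear_scale nrm)
  have "distr (spherical_law \<rho>) borel (mirror v)
      = distr (\<rho> \<Otimes>\<^sub>M ?U) borel ((\<lambda>(r, b). r *\<^sub>R sgn b) \<circ> (\<lambda>(r, b). (r, mirror v b)))"
    unfolding spherical_law_def
    by (subst distr_distr) (auto simp: comp_def case_prod_unfold eq intro!: distr_cong)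
  also have "\<dots> = distr (distr (\<rho> \<Otimes>\<^sub>M ?U) (\<rho> \<Otimes>\<^sub>M borel) (\<lambda>(r, b). (r, mirror v b))) borel (\<lambda>(r, b). r *\<^sub>R sgn b)"
    by (subst distr_distr) auto
  also have "\<dots> = spherical_law \<rho>"
    unfolding D spherical_law_def ..
  finally show ?thesis .
qed

lemma AE_spherical_law_mirror:
  assumes "AE z in spherical_law \<rho>. P z"
  shows "AE z in spherical_law \<rho>. P (mirror (v::'a::euclidean_space) z)"
  using assms
  by (subst (asm) spherical_law_mirror[of v, symmetric]) (auto dest: AE_distrD[rotated])

lemma integrable_inner_spherical_law:
  fixes c :: "'a::euclidean_space"
  assumes r2: "integrable \<rho> (\<lambda>r. r\<^sup>2)"
  shows "integrable (spherical_law \<rho>) (\<lambda>z. c \<bullet> z)"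
proof -
  let ?U = "uniform_measure lborel (ball (0::'a) 1)"
  interpret U: prob_space ?U by (rule prob_space_uniform_ball)
  interpret P: pair_prob_space \<rho> ?U ..
  have "integrable \<rho> (\<lambda>r. 1 + r\<^sup>2)" using r2 by simp
  then have r1: "integrable \<rho> (\<lambda>r. \<bar>r\<bar>)"
  proof (rule Bochner_Integration.integrable_bound)
    show "AE r in \<rho>. norm \<bar>r\<bar> \<le> norm (1 + r\<^sup>2)"
    proof (rule AE_I2)
      fix r :: real
      have "0 \<le> (\<bar>r\<bar> - 1 / 2)\<^sup>2" by simp
      then show "norm \<bar>r\<bar> \<le> norm (1 + r\<^sup>2)" by (simp add: power2_diff power_divide)
    qed
  qed measurable
  have "distr (\<rho> \<Otimes>\<^sub>M ?U) \<rho> fst = \<rho>"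
    by (rule U.distr_pair_fst)
  then have "integrable (distr (\<rho> \<Otimes>\<^sub>M ?U) \<rho> fst) (\<lambda>r. \<bar>r\<bar>)" using r1 by simp
  then have "integrable (\<rho> \<Otimes>\<^sub>M ?U) (\<lambda>x. norm c * \<bar>fst x\<bar>)"
    by (subst (asm) integrable_distr_eq) auto
  then have "integrable (\<rho> \<Otimes>\<^sub>M ?U) (\<lambda>x. c \<bullet> (fst x *\<^sub>R sgn (snd x)))"
  proof (rule Bochner_Integration.integrable_bound)
    show "AE x in \<rho> \<Otimes>\<^sub>M ?U. norm (c \<bullet> (fst x *\<^sub>R sgn (snd x))) \<le> norm (norm c * \<bar>fst x\<bar>)"
    proof (rule AE_I2)
      fix x :: "real \<times> 'a"
      have "norm (c \<bullet> (fst x *\<^sub>R sgn (snd x))) \<le> norm c * norm (fst x *\<^sub>R sgn (snd x))"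
        by (simp only: real_norm_def Cauchy_Schwarz_ineq2)
      also have "\<dots> \<le> norm c * \<bar>fst x\<bar>"
        by (intro mult_left_mono) (auto simp: norm_sgn)
      finally show "norm (c \<bullet> (fst x *\<^sub>R sgn (snd x))) \<le> norm (norm c * \<bar>fst x\<bar>)" by simp
    qed
  qed measurable
  then show ?thesis
    unfolding spherical_law_def by (subst integrable_distr_eq) (auto simp: case_prod_unfold)
qed

text \<open>The cylinder around the line spanned by \<open>a\<close> whose radius is the essential supremum of the law
  \<open>\<rho>\<close>, infinite if need be; rational radii make it a countable union.\<close>
definition reach :: "'a::euclidean_space \<Rightarrow> 'a set" where
  "reach a = {z. \<exists>q::rat. norm (perp a z) < real_of_rat q \<and> measure \<rho> {real_of_rat q<..} \<noteq> 0}"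

text \<open>Although a spherical law may be carried by a single sphere, its projection along \<open>a\<close> is
  equivalent to Lebesgue measure on a ball, possibly infinite, of the hyperplane orthogonal to \<open>a\<close>.
  This turns almost sure statements about
  cylindrical properties into statements that can be translated and integrated.\<close>
lemma AE_spherical_law_cylinder_iff:
  fixes a :: "'a::euclidean_space"
  assumes a: "norm a = 1" and [measurable]: "Measurable.pred borel P"
    and inv: "\<And>z t. P (z + t *\<^sub>R a) \<longleftrightarrow> P z"
  shows "(AE z in spherical_law \<rho>. P z) \<longleftrightarrow> (AE z in lborel. z \<in> reach a \<longrightarrow> P z)"
proof -
  define S where "S r = {z. \<not> P z \<and> norm (perp a z) < r}" for r
  have "(AE z in spherical_law \<rho>. P z) \<longleftrightarrow> (AE r in \<rho>. negligible {b \<in> ball 0 1. r *\<^sub>R sgn b \<in> {z. \<not> P z}})"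
    by (rule AE_spherical_law_iff) measurable
  also have "\<dots> \<longleftrightarrow> (AE r in \<rho>. negligible (S r))"
  proof -
    have "negligible {b \<in> ball 0 1. r *\<^sub>R sgn b \<in> {z. \<not> P z}} \<longleftrightarrow> negligible (S r)" if "0 < r" for r
      using negligible_sphere_slice_iff[OF a that, of "{z. \<not> P z}"] inv by (simp add: S_def)
    then show ?thesis
      using radius_pos by (intro iffI) (auto elim!: eventually_elim2)
  qed
  also have "\<dots> \<longleftrightarrow> negligible {z \<in> reach a. \<not> P z}"
  proof
    assume ae: "AE r in \<rho>. negligible (S r)"
    let ?I = "{q::rat. measure \<rho> {real_of_rat q<..} \<noteq> 0}"
    \<comment> \<open>The exceptional radii form a null set, so some radius beyond \<open>q\<close> is not exceptional.\<close>
    have "negligible (S (real_of_rat q))" if "q \<in> ?I" for q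
    proof (rule ccontr)
      assume "\<not> negligible (S (real_of_rat q))"
      then have "\<not> negligible (S r)" if "real_of_rat q < r" for r
        using that negligible_subset[of "S r" "S (real_of_rat q)"] by (force simp: S_def)
      then have "AE r in \<rho>. r \<notin> {real_of_rat q<..}"
        using ae by (auto elim!: eventually_mono)
      then have "measure \<rho> {real_of_rat q<..} = 0"
        by (subst (asm) AE_iff_measurable[of "{real_of_rat q<..}"]) (auto simp: measure_def)
      then show False using that by simp
    qed
    then have "negligible (\<Union>q\<in>?I. S (real_of_rat q))"
      by (intro negligible_countable_Union) auto
    moreover have "{z \<in> reach a. \<not> P z} = (\<Union>q\<in>?I. S (real_of_rat q))"
      by (auto simp: reach_def S_def)
    ultimately show "negligible {z \<in> reach a. \<not> P z}" by simp
  next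
    assume neg: "negligible {z \<in> reach a. \<not> P z}"
    have "AE r in \<rho>. \<forall>q::rat. measure \<rho> {real_of_rat q<..} = 0 \<longrightarrow> r \<le> real_of_rat q"
    proof (subst AE_all_countable, intro allI)
      fix q :: rat
      show "AE r in \<rho>. measure \<rho> {real_of_rat q<..} = 0 \<longrightarrow> r \<le> real_of_rat q"
      proof (cases "measure \<rho> {real_of_rat q<..} = 0")
        case True
        then have "AE r in \<rho>. r \<notin> {real_of_rat q<..}"
          by (subst AE_iff_measurable[of "{real_of_rat q<..}"]) (auto simp: emeasure_eq_measure)
        then show ?thesis by (auto elim!: eventually_mono)
      qed simp
    qed
    then show "AE r in \<rho>. negligible (S r)"
    proof eventually_elim
      case (elim r)
      have "S r \<subseteq> {z \<in> reach a. \<not> P z}"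
      proof
        fix z assume z: "z \<in> S r"
        obtain q where q: "norm (perp a z) < real_of_rat q" "real_of_rat q < r"
          using of_rat_dense z unfolding S_def by blast
        then have "measure \<rho> {real_of_rat q<..} \<noteq> 0" using elim by force
        then show "z \<in> {z \<in> reach a. \<not> P z}" using z q by (auto simp: reach_def S_def)
      qed
      then show ?case using neg negligible_subset by blast
    qed
  qed
  finally show ?thesis
    by (simp add: AE_lborel_iff_negligible conj_commute)
qed

lemma reach_add: "norm a = 1 \<Longrightarrow> z + t *\<^sub>R a \<in> reach a \<longleftrightarrow> z \<in> reach a"
  by (simp add: reach_def perp_add)

lemma reach_mirror:
  assumes "norm a = 1" "v \<bullet> a = 0" shows "mirror v z \<in> reach a \<longleftrightarrow> z \<in> reach a"
proof -
  have "a \<bullet> mirror v z = a \<bullet> z"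
    using inner_mirror[of v a z] assms by (simp add: mirror_orthogonal)
  then have "(norm (perp a (mirror v z)))\<^sup>2 = (norm (perp a z))\<^sup>2"
    using norm_perp[OF assms(1)] orthogonal_transformation_norm[OF orthogonal_transformation_mirror] by simp
  then have "norm (perp a (mirror v z)) = norm (perp a z)" by simp
  then show ?thesis by (simp add: reach_def)
qed

lemma open_reach: "open (reach a)"
proof -
  have "reach a = (\<Union>q::rat\<in>{q. measure \<rho> {real_of_rat q<..} \<noteq> 0}. {z. norm (perp a z) < real_of_rat q})"
    by (auto simp: reach_def)
  moreover have "open {z. norm (perp a z) < c}" for c
    unfolding perp_def by (intro open_Collect_less continuous_intros)
  ultimately show ?thesis by auto
qed

lemma reach_nonempty: "0 \<in> reach a"
proof -
  have "\<exists>q::rat. 0 < q \<and> measure \<rho> {real_of_rat q<..} \<noteq> 0"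
  proof (rule ccontr)
    assume "\<not> (\<exists>q::rat. 0 < q \<and> measure \<rho> {real_of_rat q<..} \<noteq> 0)"
    then have "AE r in \<rho>. r \<notin> {real_of_rat q<..}" if "0 < q" for q
      using that by (subst AE_iff_measurable[of "{real_of_rat q<..}"]) (auto simp: emeasure_eq_measure)
    then have "AE r in \<rho>. \<forall>q::rat. 0 < q \<longrightarrow> r \<le> real_of_rat q"
      by (subst AE_all_countable) (auto elim: eventually_mono simp: not_less)
    with radius_pos have "AE r in \<rho>. False"
    proof eventually_elim
      case (elim r)
      then show False using of_rat_dense[of 0 r] by force
    qed
    then show False by (simp add: AE_False)
  qed
  then show ?thesis by (auto simp: reach_def perp_def)
qed

text \<open>The translation invariance of \<open>\<Gamma>\<close> along \<open>e\<close> passes to \<open>\<Psi>\<close> almost everywhere. A translation by an arbitrary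
  \<open>\<tau>\<close> orthogonal to \<open>a\<close> is conjugate, by a reflection fixing \<open>a\<close>, to the translation by
  \<open>norm \<tau>\<close> along \<open>e\<close>; hence \<open>\<Psi>\<close> is invariant under all translations that stay in the cylinder, and by
  Fubini \<open>\<Psi> x = \<Psi> y\<close> for almost all pairs of points.\<close>
theorem constant_if_invariant_direction:
  fixes a e :: "'a::euclidean_space" and \<Psi> \<Gamma> :: "'a \<Rightarrow> real"
  assumes a: "norm a = 1" and e: "norm e = 1" "e \<bullet> a = 0"
    and [measurable]: "\<Psi> \<in> borel_measurable borel" "\<Gamma> \<in> borel_measurable borel"
    and \<Psi>_a: "\<And>z t. \<Psi> (z + t *\<^sub>R a) = \<Psi> z"
    and \<Gamma>_a: "\<And>z t. \<Gamma> (z + t *\<^sub>R a) = \<Gamma> z"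
    and \<Gamma>_e: "\<And>z t. \<Gamma> (z + t *\<^sub>R e) = \<Gamma> z"
    and \<Psi>_\<Gamma>: "AE z in spherical_law \<rho>. \<Psi> z = \<Gamma> z"
    and \<Psi>_mirror: "\<And>v. v \<bullet> a = 0 \<Longrightarrow> AE z in spherical_law \<rho>. \<Psi> (mirror v z) = \<Psi> z"
  shows "\<exists>c. AE z in spherical_law \<rho>. \<Psi> z = c"
proof -
  have mir_a: "mirror v (z + t *\<^sub>R a) = mirror v z + t *\<^sub>R a" if "v \<bullet> a = 0" for v z t
    using mirror_orthogonal[of v "t *\<^sub>R a"] that by (simp add: mirror_add)
  have L1: "AE z in lborel. z \<in> reach a \<longrightarrow> \<Psi> z = \<Gamma> z"
    using \<Psi>_\<Gamma> by (subst (asm) AE_spherical_law_cylinder_iff[OF a]) (auto simp: \<Psi>_a \<Gamma>_a)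
  have L2: "AE z in lborel. z \<in> reach a \<longrightarrow> \<Psi> (mirror v z) = \<Psi> z" if "v \<bullet> a = 0" for v
    using \<Psi>_mirror[OF that] by (subst (asm) AE_spherical_law_cylinder_iff[OF a]) (auto simp: \<Psi>_a mir_a that)
  have shift: "AE x in lborel. x \<in> reach a \<longrightarrow> x + \<tau> \<in> reach a \<longrightarrow> \<Psi> (x + \<tau>) = \<Psi> x" for \<tau>
  proof -
    define \<tau>' where "\<tau>' = perp a \<tau>"
    define s where "s = norm \<tau>' *\<^sub>R e"
    have a\<tau>: "a \<bullet> \<tau>' = 0" by (simp add: \<tau>'_def inner_perp a)
    \<comment> \<open>The mirror of \<open>v\<close> exchanges \<open>s\<close>, which points along \<open>e\<close>, and \<open>\<tau>'\<close>, and it fixes \<open>a\<close>.\<close>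
    define v where "v = s - \<tau>'"
    have va: "v \<bullet> a = 0" using e a\<tau> by (simp add: v_def s_def inner_diff_left inner_commute[of \<tau>'])
    have mv: "mirror v s = \<tau>'"
      unfolding v_def by (rule mirror_diff_swap) (simp add: s_def e)
    have *: "AE y in lborel. y \<in> reach a \<longrightarrow> y + s \<in> reach a \<longrightarrow> \<Psi> (mirror v y + \<tau>') = \<Psi> (mirror v y)"
      using L1 AE_lborel_shift[OF L1, of s] L2[OF va] AE_lborel_shift[OF L2[OF va], of s]
    proof eventually_elim
      case (elim y)
      then show ?case
        using \<Gamma>_e[of y "norm \<tau>'"] mv by (auto simp: mirror_add s_def)
    qed
    show ?thesis
      using AE_lborel_mirror[OF *, of v]
    proof eventually_elim
      case (elim x)
      have \<tau>: "x + \<tau> = (x + \<tau>') + (a \<bullet> \<tau>) *\<^sub>R a" by (simp add: \<tau>'_def perp_def)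
      have "mirror v x + s = mirror v (x + \<tau>')"
        using mirror_mirror[of v s] mv by (simp add: mirror_add)
      then show ?case
        using elim unfolding \<tau> by (simp add: \<Psi>_a reach_add[OF a] reach_mirror[OF a va] mirror_mirror)
    qed
  qed
  have [measurable]: "reach a \<in> sets borel" using open_reach by (rule borel_open)
  have "AE \<tau> in lborel. AE x in lborel. x \<in> reach a \<longrightarrow> x + \<tau> \<in> reach a \<longrightarrow> \<Psi> (x + \<tau>) = \<Psi> x"
    using shift by simp
  then have "AE x in lborel. AE \<tau> in lborel. x \<in> reach a \<longrightarrow> x + \<tau> \<in> reach a \<longrightarrow> \<Psi> (x + \<tau>) = \<Psi> x"
    by (subst (asm) lborel_pair.AE_commute) measurable
  then obtain x where x: "x \<in> reach a"
    and "AE \<tau> in lborel. x \<in> reach a \<longrightarrow> x + \<tau> \<in> reach a \<longrightarrow> \<Psi> (x + \<tau>) = \<Psi> x"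
    using AE_lborel_ex[OF _ open_reach reach_nonempty] by blast
  then have "AE \<tau> in lborel. x + \<tau> \<in> reach a \<longrightarrow> \<Psi> (x + \<tau>) = \<Psi> x" by simp
  from AE_lborel_shift[OF this, of "- x"] have "AE y in lborel. y \<in> reach a \<longrightarrow> \<Psi> y = \<Psi> x"
    by simp
  then have "AE y in spherical_law \<rho>. \<Psi> y = \<Psi> x"
    by (subst AE_spherical_law_cylinder_iff[OF a]) (auto simp: \<Psi>_a)
  then show ?thesis by blast
qed

end

section \<open>Increasing functions up to null sets\<close>

text \<open>The lower and upper semicontinuous regularisations of an increasing function. The upper one is
  expressed through the lower one by the symmetry \<open>G \<mapsto> (\<lambda>y. - G (- y))\<close>.\<close>
definition sup_below :: "(real ^ 'n \<Rightarrow> real) \<Rightarrow> real ^ 'n \<Rightarrow> real" where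
  "sup_below G x = (SUP q\<in>{q. \<forall>k. q $ k < x $ k}. G q)"

definition inf_above :: "(real ^ 'n \<Rightarrow> real) \<Rightarrow> real ^ 'n \<Rightarrow> real" where
  "inf_above G x = - sup_below (\<lambda>y. - G (- y)) (- x)"

context
  fixes G :: "real ^ 'n \<Rightarrow> real" and B :: real
  assumes mono: "mono G" and bounded: "\<And>x. \<bar>G x\<bar> \<le> B"
begin

lemma strictly_below_nonempty: "{q :: real ^ 'n. \<forall>k. q $ k < x $ k} \<noteq> {}"
proof -
  have "x - (\<chi> k. 1) \<in> {q. \<forall>k. q $ k < x $ k}" by simp
  then show ?thesis by blast
qed

lemma bdd_above_image: "bdd_above (G ` A)"
  using bounded by (auto intro!: bdd_aboveI[of _ B] simp: abs_le_iff)

lemma le_sup_below: "(\<And>k. q $ k < x $ k) \<Longrightarrow> G q \<le> sup_below G x"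
  unfolding sup_below_def by (rule cSUP_upper[OF _ bdd_above_image]) simp

lemma sup_below_le: "sup_below G x \<le> G x"
  unfolding sup_below_def
  by (rule cSUP_least[OF strictly_below_nonempty])
    (auto intro!: monoD[OF mono] simp: less_eq_vec_def less_imp_le)

lemma mono_sup_below: "mono (sup_below G)"
proof
  fix x y :: "real ^ 'n" assume "x \<le> y"
  then have "{q. \<forall>k. q $ k < x $ k} \<subseteq> {q. \<forall>k. q $ k < y $ k}"
    by (auto simp: less_eq_vec_def intro: less_le_trans)
  then show "sup_below G x \<le> sup_below G y"
    unfolding sup_below_def
    by (intro cSUP_subset_mono strictly_below_nonempty bdd_above_image) auto
qed

text \<open>Superlevel sets are unions of open orthants, hence open, whether or not \<open>G\<close> is measurable.\<close>
lemma measurable_sup_below: "sup_below G \<in> borel_measurable borel"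
proof (rule borel_measurableI_greater)
  fix c
  have "{x. c < sup_below G x} = (\<Union>q\<in>{q. c < G q}. {x. \<forall>k. q $ k < x $ k})"
    unfolding sup_below_def
    by (subst less_cSUP_iff[OF strictly_below_nonempty bdd_above_image]) auto
  moreover have "open {x :: real ^ 'n. \<forall>k. q $ k < x $ k}" for q
    unfolding Collect_all_eq by (intro open_INT finite ballI open_Collect_less continuous_intros)
  ultimately have "open {x. c < sup_below G x}" by auto
  then show "{x \<in> space borel. c < sup_below G x} \<in> sets borel" by simp
qed

lemma sup_below_shift:
  assumes inv: "\<And>x t. G (x + t *\<^sub>R d) = G x"
  shows "sup_below G (x + t *\<^sub>R d) = sup_below G x"
proof -
  have "{q. \<forall>k. q $ k < (x + t *\<^sub>R d) $ k} = (\<lambda>q. q + t *\<^sub>R d) ` {q. \<forall>k. q $ k < x $ k}"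
    (is "?L = ?R")
  proof (intro equalityI subsetI)
    fix q assume q: "q \<in> ?L"
    have "(q - t *\<^sub>R d) $ k < x $ k" for k
    proof -
      have "q $ k < x $ k + t * d $ k" using q by simp
      then show ?thesis by (simp only: vector_minus_component vector_scaleR_component real_scaleR_def diff_less_eq)
    qed
    then show "q \<in> ?R"
      by (intro image_eqI[of _ _ "q - t *\<^sub>R d"]) auto
  qed auto
  then show ?thesis
    unfolding sup_below_def by (simp add: image_image inv)
qed

end

lemma inf_above_facts:
  fixes G :: "real ^ 'n \<Rightarrow> real"
  assumes mono: "mono G" and bounded: "\<And>x. \<bar>G x\<bar> \<le> B"
  shows inf_above_le: "(\<And>k. x $ k < q $ k) \<Longrightarrow> inf_above G x \<le> G q"
    and le_inf_above: "G x \<le> inf_above G x"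
    and measurable_inf_above: "inf_above G \<in> borel_measurable borel"
    and inf_above_shift: "(\<And>x t. G (x + t *\<^sub>R d) = G x) \<Longrightarrow> inf_above G (x + t *\<^sub>R d) = inf_above G x"
proof -
  have m: "mono (\<lambda>y. - G (- y))"
    using mono by (auto simp: mono_def less_eq_vec_def)
  have b: "\<bar>- G (- y)\<bar> \<le> B" for y
    using bounded by simp
  show "inf_above G x \<le> G q" if "\<And>k. x $ k < q $ k"
    using le_sup_below[OF m b, of "- q" "- x"] that by (simp add: inf_above_def)
  show "G x \<le> inf_above G x"
    using sup_below_le[OF m b, of "- x"] by (simp add: inf_above_def)
  show "inf_above G \<in> borel_measurable borel"
    using measurable_compose[OF borel_measurable_uminus[OF measurable_ident] measurable_sup_below[OF m b]]
    unfolding inf_above_def by simp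
  show "inf_above G (x + t *\<^sub>R d) = inf_above G x" if "\<And>x t. G (x + t *\<^sub>R d) = G x"
  proof -
    have "- G (- (y + s *\<^sub>R d)) = - G (- y)" for y s
      using that[of "- y" "- s"] by simp
    from sup_below_shift[OF m b this, of "- x" "- t"] show ?thesis
      by (simp add: inf_above_def)
  qed
qed

text \<open>On each line in the diagonal direction \<open>(1, \<dots>, 1)\<close> the two regularisations differ at most at the
  countably many jumps of an increasing function of one variable; Fubini turns this into a statement
  about Lebesgue measure.\<close>
lemma AE_sup_below_eq_inf_above:
  fixes G :: "real ^ 'n \<Rightarrow> real"
  assumes mono: "mono G" and bounded: "\<And>x. \<bar>G x\<bar> \<le> B"
  shows "AE x in lborel. sup_below G x = inf_above G x"
proof -
  let ?one = "(\<chi> k. 1) :: real ^ 'n"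
  note [measurable] = measurable_sup_below[OF assms] measurable_inf_above[OF assms]
  have "AE s in lborel. sup_below G (x + s *\<^sub>R ?one) = inf_above G (x + s *\<^sub>R ?one)" for x
  proof -
    define \<phi> where "\<phi> s = sup_below G (x + s *\<^sub>R ?one)" for s
    have "mono \<phi>"
      unfolding \<phi>_def by (intro monoI monoD[OF mono_sup_below[OF assms]]) (auto simp: less_eq_vec_def)
    then have "countable {s. \<not> isCont \<phi> s}" by (rule mono_ctble_discont)
    then have "AE s in lborel. isCont \<phi> s"
      using AE_not_in[OF countable_imp_null_set_lborel] by fastforce
    then show ?thesis
    proof eventually_elim
      case (elim s)
      have "inf_above G (x + s *\<^sub>R ?one) \<le> \<phi> s"
      proof (rule tendsto_lowerbound)
        show "(\<phi> \<longlongrightarrow> \<phi> s) (at_right s)"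
          using elim by (simp add: isCont_def filterlim_at_split)
        show "\<forall>\<^sub>F s' in at_right s. inf_above G (x + s *\<^sub>R ?one) \<le> \<phi> s'"
        proof (rule eventually_mono[OF eventually_at_right_less])
          fix s' assume "s < s'"
          define q where "q = x + ((s + s') / 2) *\<^sub>R ?one"
          have "inf_above G (x + s *\<^sub>R ?one) \<le> G q"
            using \<open>s < s'\<close> by (intro inf_above_le[OF assms]) (simp add: q_def)
          also have "G q \<le> \<phi> s'"
            unfolding \<phi>_def using \<open>s < s'\<close> by (intro le_sup_below[OF assms]) (simp add: q_def)
          finally show "inf_above G (x + s *\<^sub>R ?one) \<le> \<phi> s'" .
        qed
      qed simp
      moreover have "\<phi> s \<le> inf_above G (x + s *\<^sub>R ?one)"
        unfolding \<phi>_def using sup_below_le[OF assms] le_inf_above[OF assms] order_trans by blast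
      ultimately show ?case by (simp add: \<phi>_def)
    qed
  qed
  then have "AE x in lborel. AE s in lborel. sup_below G (x + s *\<^sub>R ?one) = inf_above G (x + s *\<^sub>R ?one)"
    by simp
  then have "AE s in lborel. AE x in lborel. sup_below G (x + s *\<^sub>R ?one) = inf_above G (x + s *\<^sub>R ?one)"
    by (subst (asm) lborel_pair.AE_commute) measurable
  then obtain s where "AE x in lborel. sup_below G (x + s *\<^sub>R ?one) = inf_above G (x + s *\<^sub>R ?one)"
    using AE_lborel_ex[OF _ open_UNIV UNIV_I] by blast
  from AE_lborel_shift[OF this, of "- s *\<^sub>R ?one"] show ?thesis
    by (simp add: scaleR_minus_left)
qed

section \<open>Conditional expectation given a hyperplane projection\<close>

text \<open>\<open>\<Phi>\<close> is a version of the conditional expectation of \<open>H\<close> given the projection onto the hyperplane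
  orthogonal to \<open>a\<close>: the functions of that projection are those invariant along \<open>a\<close>. Unlike an abstract
  conditional expectation, \<open>\<Phi>\<close> is exactly invariant along \<open>a\<close>, and reflections act on it by composition.\<close>
definition cylinder_cond_exp ::
  "'b::euclidean_space measure \<Rightarrow> 'b \<Rightarrow> ('b \<Rightarrow> real) \<Rightarrow> ('b \<Rightarrow> real) \<Rightarrow> bool" where
  "cylinder_cond_exp \<gamma> a H \<Phi> \<longleftrightarrow>
     integrable \<gamma> H \<and> integrable \<gamma> \<Phi> \<and> \<Phi> \<in> borel_measurable borel \<and>
     (\<forall>z t. \<Phi> (z + t *\<^sub>R a) = \<Phi> z) \<and>
     (\<forall>k B. k \<in> borel_measurable borel \<longrightarrow> (\<forall>z. \<bar>k z\<bar> \<le> B) \<longrightarrow> (\<forall>z t. k (z + t *\<^sub>R a) = k z) \<longrightarrow>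
        (LINT z|\<gamma>. H z * k z) = (LINT z|\<gamma>. \<Phi> z * k z))"

lemma integrable_mult_bounded:
  fixes H k :: "'b \<Rightarrow> real"
  assumes H: "integrable \<gamma> H" and [measurable]: "k \<in> borel_measurable \<gamma>" and k: "\<And>z. \<bar>k z\<bar> \<le> B"
  shows "integrable \<gamma> (\<lambda>z. H z * k z)"
proof (rule Bochner_Integration.integrable_bound)
  show "integrable \<gamma> (\<lambda>z. B * H z)" using H by simp
  show "(\<lambda>z. H z * k z) \<in> borel_measurable \<gamma>" using H by (intro borel_measurable_times) auto
  have "\<bar>H z\<bar> * \<bar>k z\<bar> \<le> \<bar>B\<bar> * \<bar>H z\<bar>" for z
    using mult_left_mono[of "\<bar>k z\<bar>" "\<bar>B\<bar>" "\<bar>H z\<bar>"] k[of z] by (simp add: mult.commute)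
  then show "AE z in \<gamma>. norm (H z * k z) \<le> norm (B * H z)"
    by (simp add: abs_mult)
qed

text \<open>Testing with \<open>k = sgn (\<Phi> - \<Phi>')\<close> gives that \<open>\<bar>\<Phi> - \<Phi>'\<bar>\<close> has integral zero.\<close>
lemma cylinder_cond_exp_unique:
  assumes "sets \<gamma> = sets borel"
    and 1: "cylinder_cond_exp \<gamma> a H \<Phi>" and 2: "cylinder_cond_exp \<gamma> a H \<Phi>'"
  shows "AE z in \<gamma>. \<Phi> z = \<Phi>' z"
proof -
  note [measurable_cong] = assms(1)
  have [measurable]: "\<Phi> \<in> borel_measurable borel" "\<Phi>' \<in> borel_measurable borel"
    and int: "integrable \<gamma> \<Phi>" "integrable \<gamma> \<Phi>'"
    and inv: "\<And>z t. \<Phi> (z + t *\<^sub>R a) = \<Phi> z" "\<And>z t. \<Phi>' (z + t *\<^sub>R a) = \<Phi>' z"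
    using 1 2 by (auto simp: cylinder_cond_exp_def)
  define k where "k z = sgn (\<Phi> z - \<Phi>' z)" for z
  have [measurable]: "k \<in> borel_measurable borel" unfolding k_def by measurable
  have k: "\<bar>k z\<bar> \<le> 1" "k (z + t *\<^sub>R a) = k z" for z t
    by (auto simp: k_def inv sgn_if)
  have "(LINT z|\<gamma>. \<Phi> z * k z) = (LINT z|\<gamma>. \<Phi>' z * k z)"
    using 1 2 k unfolding cylinder_cond_exp_def by (metis \<open>k \<in> borel_measurable borel\<close>)
  moreover have "integrable \<gamma> (\<lambda>z. \<Phi> z * k z)" "integrable \<gamma> (\<lambda>z. \<Phi>' z * k z)"
    using k by (auto intro!: integrable_mult_bounded[where B=1] int)
  ultimately have "(LINT z|\<gamma>. \<bar>\<Phi> z - \<Phi>' z\<bar>) = 0"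
    by (subst (asm) eq_iff_diff_eq_0, subst (asm) Bochner_Integration.integral_diff[symmetric])
      (auto simp: k_def sgn_mult_abs left_diff_distrib[symmetric] mult.commute abs_sgn)
  then have "AE z in \<gamma>. \<bar>\<Phi> z - \<Phi>' z\<bar> = 0"
    using int by (subst (asm) integral_nonneg_eq_0_iff_AE) auto
  then show ?thesis by (auto elim: eventually_mono)
qed

text \<open>A symmetry of the law that fixes both \<open>H\<close> and the direction \<open>a\<close> transforms versions of the conditional
  expectation of \<open>H\<close> into versions of it; with uniqueness, it leaves them almost surely unchanged.\<close>
lemma cylinder_cond_exp_mirror:
  assumes s: "sets \<gamma> = sets borel" and \<gamma>: "distr \<gamma> borel (mirror v) = \<gamma>" and v: "v \<bullet> a = 0"
    and H: "\<And>z. H (mirror v z) = H z" and CE: "cylinder_cond_exp \<gamma> a H \<Phi>"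
  shows "cylinder_cond_exp \<gamma> a H (\<lambda>z. \<Phi> (mirror v z))"
proof -
  note [measurable_cong] = s
  have [measurable]: "\<Phi> \<in> borel_measurable borel" and int: "integrable \<gamma> \<Phi>" and H_int: "integrable \<gamma> H"
    using CE by (auto simp: cylinder_cond_exp_def)
  have H_m [measurable]: "H \<in> borel_measurable borel"
    using H_int s by (simp add: measurable_cong_sets[OF s refl, symmetric] borel_measurable_integrable)
  have mir_a: "mirror v (z + t *\<^sub>R a) = mirror v z + t *\<^sub>R a" for z t
    using mirror_orthogonal[of v "t *\<^sub>R a"] v by (simp add: mirror_add)
  have flip: "(LINT z|\<gamma>. F (mirror v z)) = (LINT z|\<gamma>. F z)" if [measurable]: "F \<in> borel_measurable borel"
    for F :: "'a \<Rightarrow> real"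
    by (subst (2) \<gamma>[symmetric], subst integral_distr) auto
  have "(LINT z|\<gamma>. H z * k z) = (LINT z|\<gamma>. \<Phi> (mirror v z) * k z)"
    if [measurable]: "k \<in> borel_measurable borel" and k: "\<And>z. \<bar>k z\<bar> \<le> B" "\<And>z t. k (z + t *\<^sub>R a) = k z" for k B
  proof -
    have "(LINT z|\<gamma>. H z * k z) = (LINT z|\<gamma>. H z * k (mirror v z))"
      using flip[of "\<lambda>z. H z * k z"] by (simp add: H)
    also have "\<dots> = (LINT z|\<gamma>. \<Phi> z * k (mirror v z))"
    proof -
      have "(\<lambda>z. k (mirror v z)) \<in> borel_measurable borel" by measurable
      moreover have "\<forall>z. \<bar>k (mirror v z)\<bar> \<le> B" "\<forall>z t. k (mirror v (z + t *\<^sub>R a)) = k (mirror v z)"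
        using k by (simp_all only: mir_a simp_thms)
      ultimately show ?thesis using CE unfolding cylinder_cond_exp_def by blast
    qed
    also have "\<dots> = (LINT z|\<gamma>. \<Phi> (mirror v z) * k z)"
      using flip[of "\<lambda>z. \<Phi> z * k (mirror v z)"] by (simp add: mirror_mirror)
    finally show ?thesis .
  qed
  moreover have "integrable \<gamma> (\<lambda>z. \<Phi> (mirror v z))"
    using int by (subst (asm) \<gamma>[symmetric], subst (asm) integrable_distr_eq) auto
  moreover have "(\<lambda>z. \<Phi> (mirror v z)) \<in> borel_measurable borel" by measurable
  moreover have "\<Phi> (mirror v (z + t *\<^sub>R a)) = \<Phi> (mirror v z)" for z t
    using CE by (simp add: mir_a cylinder_cond_exp_def)
  ultimately show ?thesis
    using H_int unfolding cylinder_cond_exp_def by blast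
qed

lemma cylinder_cond_exp_diff:
  assumes s: "sets \<gamma> = sets borel" and "cylinder_cond_exp \<gamma> a H \<Phi>" "cylinder_cond_exp \<gamma> a H' \<Phi>'"
  shows "cylinder_cond_exp \<gamma> a (\<lambda>z. H z - H' z) (\<lambda>z. \<Phi> z - \<Phi>' z)"
proof -
  have "integrable \<gamma> (\<lambda>z. F z * k z)" if "integrable \<gamma> F" "k \<in> borel_measurable borel" "\<forall>z. \<bar>k z\<bar> \<le> B"
    for F k :: "'a \<Rightarrow> real" and B
    using that s by (intro integrable_mult_bounded[where B=B]) (auto simp: measurable_cong_sets[OF s refl])
  then show ?thesis
    using assms unfolding cylinder_cond_exp_def by (auto simp: left_diff_distrib)
qed

lemma cylinder_cond_exp_add:
  assumes s: "sets \<gamma> = sets borel" and "cylinder_cond_exp \<gamma> a H \<Phi>" "cylinder_cond_exp \<gamma> a H' \<Phi>'"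
  shows "cylinder_cond_exp \<gamma> a (\<lambda>z. H z + H' z) (\<lambda>z. \<Phi> z + \<Phi>' z)"
proof -
  have "integrable \<gamma> (\<lambda>z. F z * k z)" if "integrable \<gamma> F" "k \<in> borel_measurable borel" "\<forall>z. \<bar>k z\<bar> \<le> B"
    for F k :: "'a \<Rightarrow> real" and B
    using that s by (intro integrable_mult_bounded[where B=B]) (auto simp: measurable_cong_sets[OF s refl])
  then show ?thesis
    using assms unfolding cylinder_cond_exp_def by (auto simp: distrib_right)
qed

lemma cylinder_cond_exp_mult:
  assumes s: "sets \<gamma> = sets borel" and CE: "cylinder_cond_exp \<gamma> a H \<Phi>"
    and [measurable]: "m \<in> borel_measurable borel" and m: "\<And>z. \<bar>m z\<bar> \<le> 1" "\<And>z t. m (z + t *\<^sub>R a) = m z"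
  shows "cylinder_cond_exp \<gamma> a (\<lambda>z. m z * H z) (\<lambda>z. m z * \<Phi> z)"
proof -
  have "(LINT z|\<gamma>. (m z * H z) * k z) = (LINT z|\<gamma>. (m z * \<Phi> z) * k z)"
    if [measurable]: "k \<in> borel_measurable borel" and k: "\<forall>z. \<bar>k z\<bar> \<le> B" "\<forall>z t. k (z + t *\<^sub>R a) = k z" for k B
  proof -
    have "(\<lambda>z. m z * k z) \<in> borel_measurable borel" by measurable
    moreover have "\<forall>z. \<bar>m z * k z\<bar> \<le> B"
    proof
      fix z show "\<bar>m z * k z\<bar> \<le> B"
        using mult_mono[of "\<bar>m z\<bar>" 1 "\<bar>k z\<bar>" B] m(1)[of z] k(1) by (auto simp: abs_mult)
    qed
    moreover have "\<forall>z t. m (z + t *\<^sub>R a) * k (z + t *\<^sub>R a) = m z * k z" using k m by simp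
    ultimately have "(LINT z|\<gamma>. H z * (m z * k z)) = (LINT z|\<gamma>. \<Phi> z * (m z * k z))"
      using CE unfolding cylinder_cond_exp_def by blast
    then show ?thesis by (simp add: ac_simps)
  qed
  moreover have "integrable \<gamma> (\<lambda>z. m z * H z)" "integrable \<gamma> (\<lambda>z. m z * \<Phi> z)"
    using CE m(1) integrable_mult_bounded[of \<gamma> _ m 1]
    by (auto simp: cylinder_cond_exp_def measurable_cong_sets[OF s refl] mult.commute)
  moreover have "(\<lambda>z. m z * \<Phi> z) \<in> borel_measurable borel"
    using CE by (auto simp: cylinder_cond_exp_def)
  moreover have "m (z + t *\<^sub>R a) * \<Phi> (z + t *\<^sub>R a) = m z * \<Phi> z" for z t
    using CE m(2) by (simp add: cylinder_cond_exp_def)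
  ultimately show ?thesis
    unfolding cylinder_cond_exp_def by blast
qed

section \<open>Conditionally increasing vectors\<close>

lemma measurable_vec_nth[measurable]: "(\<lambda>x :: real ^ 'n. x $ k) \<in> borel_measurable borel"
  by (intro borel_measurable_continuous_onI continuous_intros)

lemma subvector_in_PiE: "subvector Y C \<omega> \<in> C \<rightarrow>\<^sub>E UNIV"
  by (simp add: subvector_def)

lemma measurable_subvector:
  assumes [measurable]: "Y \<in> borel_measurable M"
  shows "subvector Y C \<in> measurable M (\<Pi>\<^sub>M j\<in>C. borel)"
  unfolding subvector_def[abs_def] by measurable

lemma subalgebra_sigma_of_subvector:
  assumes [measurable]: "Y \<in> borel_measurable M"
  shows "subalgebra M (sigma_of_subvector M Y C)"
  using measurable_subvector[OF assms, of C]
  by (simp add: subalgebra_def sigma_of_subvector_def measurable_iff_sets)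

text \<open>The conditional expectation given \<open>Y\<^sub>C\<close> is an increasing function \<open>g\<close> of \<open>Y\<^sub>C\<close>; it has to be rewritten as
  an increasing function of \<open>X = f(Y)\<close> defined everywhere, although the range of \<open>f\<close> may have gaps and
  be bounded. Taking the supremum of \<open>g\<close> over all \<open>p\<close> with \<open>f(p) \<le> x\<close> works once \<open>g\<close> is made bounded by
  the arctangent; the value \<open>-2\<close>, below its range, covers the points \<open>x\<close> with no such \<open>p\<close>.\<close>
lemma cond_exp_increasing_version:
  fixes Y :: "'a \<Rightarrow> real ^ 'n"
  assumes f: "\<And>i. strict_mono (f i)" and CI: "conditionally_increasing M Y"
    and h: "mono h" "integrable M (\<lambda>\<omega>. h (coordinatewise f Y \<omega> $ i))"
  obtains G :: "real ^ 'n \<Rightarrow> real" where "mono G" "\<And>x. \<bar>G x\<bar> \<le> 2" "\<And>x t. G (x + t *\<^sub>R axis i 1) = G x"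
    "AE \<omega> in M. arctan (real_cond_exp M (sigma_of_subvector M Y (UNIV - {i}))
        (\<lambda>\<omega>. h (coordinatewise f Y \<omega> $ i)) \<omega>) = G (coordinatewise f Y \<omega>)"
proof -
  let ?C = "UNIV - {i}"
  have "mono (\<lambda>y. h (f i y))"
    using h(1) strict_mono_mono[OF f[of i]] by (simp add: mono_def)
  moreover have "integrable M (\<lambda>\<omega>. h (f i (Y \<omega> $ i)))"
    using h(2) by (simp add: coordinatewise_def)
  ultimately obtain g where g: "mono_on (?C \<rightarrow>\<^sub>E UNIV) g"
    and ae: "AE \<omega> in M. real_cond_exp M (sigma_of_subvector M Y ?C) (\<lambda>\<omega>. h (f i (Y \<omega> $ i))) \<omega> = g (subvector Y ?C \<omega>)"
    using CI[unfolded conditionally_increasing_def, THEN conjunct2, rule_format, of ?C i "\<lambda>y. h (f i y)"]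
    by auto
  define D where "D x = insert (-2) {arctan (g p) | p. p \<in> ?C \<rightarrow>\<^sub>E UNIV \<and> (\<forall>k\<in>?C. f k (p k) \<le> x $ k)}" for x :: "real ^ 'n"
  define G where "G x = Sup (D x)" for x
  have D_le: "d \<le> 2" if "d \<in> D x" for d x
    using that pi_less_4 by (auto simp: D_def intro!: less_imp_le[OF less_trans[OF arctan_ubound]])
  then have bdd: "bdd_above (D x)" for x by (auto intro!: bdd_aboveI)
  have ne: "D x \<noteq> {}" for x by (simp add: D_def)
  have "mono G"
  proof
    fix x y :: "real ^ 'n" assume "x \<le> y"
    then have "D x \<subseteq> D y"
      unfolding D_def less_eq_vec_def by (blast intro: order_trans)
    then show "G x \<le> G y"
      unfolding G_def by (intro cSup_subset_mono ne bdd)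
  qed
  moreover have "\<bar>G x\<bar> \<le> 2" for x
  proof -
    have "-2 \<le> G x" unfolding G_def by (rule cSup_upper[OF _ bdd]) (simp add: D_def)
    moreover have "G x \<le> 2" unfolding G_def by (rule cSup_least[OF ne D_le])
    ultimately show ?thesis by simp
  qed
  moreover have "G (x + t *\<^sub>R axis i 1) = G x" for x t
  proof -
    have "axis i 1 $ k = (0::real)" if "k \<noteq> i" for k
      using that by (simp add: axis_def)
    then have "(\<forall>k\<in>?C. f k (p k) \<le> (x + t *\<^sub>R axis i 1) $ k) \<longleftrightarrow> (\<forall>k\<in>?C. f k (p k) \<le> x $ k)" for p
      by (intro ball_cong) auto
    then have "D (x + t *\<^sub>R axis i 1) = D x" unfolding D_def by simp
    then show ?thesis by (simp add: G_def)
  qed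
  moreover have "G (coordinatewise f Y \<omega>) = arctan (g (subvector Y ?C \<omega>))" for \<omega>
    unfolding G_def
  proof (rule cSup_eq_maximum)
    show "arctan (g (subvector Y ?C \<omega>)) \<in> D (coordinatewise f Y \<omega>)"
      unfolding D_def using subvector_in_PiE[of Y ?C \<omega>]
      by (intro insertI2 CollectI exI[of _ "subvector Y ?C \<omega>"]) (simp add: subvector_def coordinatewise_def)
    fix d assume "d \<in> D (coordinatewise f Y \<omega>)"
    then consider "d = -2" | p where "d = arctan (g p)" "p \<in> ?C \<rightarrow>\<^sub>E UNIV" "\<forall>k\<in>?C. f k (p k) \<le> f k (Y \<omega> $ k)"
      by (auto simp: D_def coordinatewise_def)
    then show "d \<le> arctan (g (subvector Y ?C \<omega>))"
    proof cases
      case 1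
      then show ?thesis using arctan_lbound[of "g (subvector Y ?C \<omega>)"] pi_less_4 by linarith
    next
      case (2 p)
      have "p \<le> subvector Y ?C \<omega>"
      proof (rule le_funI)
        fix k show "p k \<le> subvector Y ?C \<omega> k"
        proof (cases "k = i")
          case True
          then show ?thesis using PiE_arb[OF 2(2)] by (simp add: subvector_def)
        next
          case False
          then have "f k (p k) \<le> f k (Y \<omega> $ k)" using 2(3) by simp
          then show ?thesis using False strict_mono_less_eq[OF f[of k]] by (simp add: subvector_def)
        qed
      qed
      then have "g p \<le> g (subvector Y ?C \<omega>)"
        by (rule mono_onD[OF g 2(2) subvector_in_PiE])
      then show ?thesis using 2 by (simp add: arctan_monotone')
    qed
  qed
  ultimately show thesis
    using ae by (intro that[of G]) (auto simp: coordinatewise_def)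
qed

text \<open>A function of \<open>X = f(Y)\<close> that ignores the \<open>i\<close>-th coordinate is a function of the other coordinates
  of \<open>Y\<close>, so it may be pulled into the conditional expectation.\<close>
lemma integral_real_cond_exp_subvector:
  fixes Y :: "'a \<Rightarrow> real ^ 'n"
  assumes "prob_space M" and f: "\<And>i. strict_mono (f i)"
    and [measurable]: "Y \<in> borel_measurable M" "coordinatewise f Y \<in> borel_measurable M"
    and H: "integrable M H"
    and [measurable]: "k \<in> borel_measurable borel" and k: "\<And>x. \<bar>k x\<bar> \<le> B" "\<And>x t. k (x + t *\<^sub>R axis i 1) = k x"
  shows "(LINT \<omega>|M. H \<omega> * k (coordinatewise f Y \<omega>)) =
     (LINT \<omega>|M. real_cond_exp M (sigma_of_subvector M Y (UNIV - {i})) H \<omega> * k (coordinatewise f Y \<omega>))"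
proof -
  let ?C = "UNIV - {i}" and ?F = "sigma_of_subvector M Y (UNIV - {i})"
  interpret prob_space M by fact
  interpret finite_measure_subalgebra M ?F
    by unfold_locales (rule subalgebra_sigma_of_subvector, fact)
  have [measurable]: "f l \<in> borel_measurable borel" for l
    using strict_mono_mono[OF f] by (rule borel_measurable_mono)
  define k' where "k' p = k (\<Sum>l\<in>?C. f l (p l) *\<^sub>R axis l 1)" for p
  have "k' \<in> borel_measurable (\<Pi>\<^sub>M j\<in>?C. borel)"
    unfolding k'_def by measurable
  moreover have "subvector Y ?C \<in> measurable ?F (\<Pi>\<^sub>M j\<in>?C. borel)"
    unfolding sigma_of_subvector_def
    by (rule measurable_vimage_algebra1) (auto simp: space_PiM subvector_in_PiE)
  ultimately have "(\<lambda>\<omega>. k' (subvector Y ?C \<omega>)) \<in> borel_measurable ?F"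
    by (rule measurable_compose[rotated])
  moreover have "k' (subvector Y ?C \<omega>) = k (coordinatewise f Y \<omega>)" for \<omega>
  proof -
    have "coordinatewise f Y \<omega> = (\<Sum>l\<in>UNIV. f l (Y \<omega> $ l) *\<^sub>R axis l 1)"
      by (subst basis_expansion[symmetric]) (simp add: coordinatewise_def scalar_mult_eq_scaleR)
    also have "\<dots> = (\<Sum>l\<in>?C. f l (Y \<omega> $ l) *\<^sub>R axis l 1) + f i (Y \<omega> $ i) *\<^sub>R axis i 1"
      by (subst sum.remove[of _ i]) auto
    finally show ?thesis
      by (simp add: k'_def k subvector_def)
  qed
  ultimately have kF: "(\<lambda>\<omega>. k (coordinatewise f Y \<omega>)) \<in> borel_measurable ?F" by simp
  have "integrable M (\<lambda>\<omega>. k (coordinatewise f Y \<omega>) * H \<omega>)"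
    using integrable_mult_bounded[OF H, of "\<lambda>\<omega>. k (coordinatewise f Y \<omega>)" B] k(1) by (simp add: mult.commute)
  from real_cond_exp_intg(2)[OF this kF] H show ?thesis
    by (simp add: mult.commute)
qed

section \<open>A multiplicative functional equation\<close>

text \<open>Cauchy's functional equation for \<open>- ln \<phi>\<close>. Boundedness makes \<open>- ln \<phi>\<close> nonnegative and hence
  increasing, which forces linearity; the limit hypothesis excludes that \<open>\<phi>\<close> vanishes somewhere.\<close>
lemma multiplicative_bounded_exp:
  fixes \<phi> :: "real \<Rightarrow> real"
  assumes mult: "\<And>p q. 0 \<le> p \<Longrightarrow> 0 \<le> q \<Longrightarrow> \<phi> (p + q) = \<phi> p * \<phi> q"
    and le: "\<And>p. 0 \<le> p \<Longrightarrow> \<bar>\<phi> p\<bar> \<le> 1"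
    and lim: "\<And>p. 0 \<le> p \<Longrightarrow> (\<lambda>n. \<phi> (p / 2 ^ n)) \<longlonglongrightarrow> 1"
  obtains c where "0 \<le> c" "\<And>p. 0 \<le> p \<Longrightarrow> \<phi> p = exp (- c * p)"
proof -
  have zero: "\<phi> 0 = 1"
    using lim[of 0] by (simp add: LIMSEQ_const_iff)
  have half: "\<phi> p = (\<phi> (p / 2))\<^sup>2" if "0 \<le> p" for p
    using mult[of "p / 2" "p / 2"] that by (simp add: power2_eq_square)
  have nz: "\<phi> p \<noteq> 0" if p: "0 \<le> p" for p
  proof
    assume 0: "\<phi> p = 0"
    have "\<phi> (p / 2 ^ n) = 0" for n
    proof (induction n)
      case (Suc n)
      then show ?case using half[of "p / 2 ^ n"] p by (simp add: field_simps)
    qed (simp add: 0)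
    then show False using lim[OF p] by (simp add: LIMSEQ_const_iff)
  qed
  have pos: "0 < \<phi> p" if "0 \<le> p" for p
    using half[OF that] nz[OF that] zero_le_power2[of "\<phi> (p / 2)"] by linarith
  define l where "l p = - ln (\<phi> p)" for p
  have l_nonneg: "0 \<le> l p" if "0 \<le> p" for p
    using le[OF that] pos[OF that] by (simp add: l_def)
  have l_add: "l (p + q) = l p + l q" if "0 \<le> p" "0 \<le> q" for p q
    using mult[OF that] pos[OF that(1)] pos[OF that(2)] by (simp add: l_def ln_mult)
  have l_mono: "l p \<le> l q" if "0 \<le> p" "p \<le> q" for p q
    using l_add[of p "q - p"] l_nonneg[of "q - p"] that by simp
  have l_nat: "l (real n * p) = real n * l p" if "0 \<le> p" for n p
  proof (induction n)
    case 0
    then show ?case by (simp add: l_def zero)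
  next
    case (Suc n)
    then show ?case using l_add[of "real n * p" p] that by (simp add: algebra_simps)
  qed
  have lin: "l p = p * l 1" if p: "0 \<le> p" for p
  proof -
    have bound: "\<bar>l p - p * l 1\<bar> \<le> l 1 / real (Suc n)" for n
    proof -
      let ?m = "real (Suc n)"
      define k where "k = nat \<lfloor>?m * p\<rfloor>"
      have k: "real k \<le> ?m * p" "?m * p \<le> real (k + 1)"
        unfolding k_def using p by (auto simp: of_nat_nat) linarith
      have "real k * l 1 \<le> ?m * l p"
        using l_mono[of "real k" "?m * p"] l_nat[of 1 k] l_nat[OF p, of "Suc n"] k by simp
      moreover have "?m * l p \<le> real (k + 1) * l 1"
        using l_mono[of "?m * p" "real (k + 1)"] l_nat[of 1 "k + 1"] l_nat[OF p, of "Suc n"] k p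
        by (simp only: mult_1_right zero_le_mult_iff) simp
      moreover have "real k * l 1 \<le> ?m * p * l 1" "?m * p * l 1 \<le> real (k + 1) * l 1"
        using k l_nonneg[of 1] by (auto intro!: mult_right_mono)
      ultimately have "\<bar>?m * l p - ?m * p * l 1\<bar> \<le> l 1"
        by (simp add: abs_le_iff distrib_right)
      moreover have "\<bar>?m * l p - ?m * p * l 1\<bar> = ?m * \<bar>l p - p * l 1\<bar>"
        by (simp only: mult.assoc right_diff_distrib[symmetric] abs_mult abs_of_nat)
      ultimately have "?m * \<bar>l p - p * l 1\<bar> \<le> l 1" by simp
      then show ?thesis by (simp add: pos_le_divide_eq mult.commute del: of_nat_Suc)
    qed
    have "(\<lambda>n. l 1 / real (Suc n)) \<longlonglongrightarrow> 0"
      by (rule LIMSEQ_Suc[OF lim_const_over_n])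
    then have "\<bar>l p - p * l 1\<bar> \<le> 0"
      by (rule LIMSEQ_le_const) (use bound in blast)
    then show ?thesis by simp
  qed
  show thesis
  proof (rule that[of "l 1"])
    show "0 \<le> l 1" by (rule l_nonneg) simp
    fix p :: real assume p: "0 \<le> p"
    then have "\<phi> p = exp (- l p)" using pos by (simp add: l_def)
    then show "\<phi> p = exp (- l 1 * p)" using lin[OF p] by (simp add: mult.commute)
  qed
qed

text \<open>They exhibit the cosine and the sine as differences of increasing functions, so that conditional
  increasingness applies; the linear terms are integrable at every integrable random variable.\<close>
lemma mono_plus_cos: "0 \<le> s \<Longrightarrow> mono (\<lambda>y::real. s * y + cos (s * y))"
  and mono_plus_sin: "0 \<le> s \<Longrightarrow> mono (\<lambda>y::real. s * y + sin (s * y))"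
proof -
  assume s: "0 \<le> s"
  have nonneg: "0 \<le> s - sin (s * y) * s" "0 \<le> s + cos (s * y) * s" for y
    using mult_right_mono[of "sin (s * y)" 1 s] mult_right_mono[of "- 1" "cos (s * y)" s] s
    by simp_all
  have deriv: "((\<lambda>y. s * y + cos (s * y)) has_real_derivative s - sin (s * y) * s) (at y)"
    "((\<lambda>y. s * y + sin (s * y)) has_real_derivative s + cos (s * y) * s) (at y)" for y
    by (auto intro!: derivative_eq_intros)
  show "mono (\<lambda>y::real. s * y + cos (s * y))"
    by (rule monoI, rule DERIV_nonneg_imp_nondecreasing, assumption) (use deriv(1) nonneg(1) in blast)
  show "mono (\<lambda>y::real. s * y + sin (s * y))"
    by (rule monoI, rule DERIV_nonneg_imp_nondecreasing, assumption) (use deriv(2) nonneg(2) in blast)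
qed

section \<open>Elliptical vectors in whitened coordinates\<close>

text \<open>The vector \<open>X = \<mu> + R Z\<close> seen through \<open>Z\<close>, for a zero entry \<open>(i, j)\<close> of the concentration matrix:
  the inner product of the columns \<open>i\<close> and \<open>j\<close> of \<open>R' = R\<^sup>-\<^sup>1\<close> is that entry.\<close>
locale whitened_frame = positive_radius \<rho> for \<rho> :: "real measure" +
  fixes R R' :: "real ^ 'n ^ 'n" and \<mu> :: "real ^ 'n" and i j :: 'n
  assumes R_inverse: "R ** R' = mat 1" "R' ** R = mat 1"
    and second_moment: "integrable \<rho> (\<lambda>r. r\<^sup>2)"
    and orthogonal: "(R' *v axis i 1) \<bullet> (R' *v axis j 1) = 0"
begin

definition point :: "real ^ 'n \<Rightarrow> real ^ 'n" where
  "point z = \<mu> + R *v z"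

text \<open>The direction in which \<open>Z\<close> has to move in order to change only the \<open>k\<close>-th coordinate of \<open>X\<close>.\<close>
definition dir :: "'n \<Rightarrow> real ^ 'n" where
  "dir k = R' *v axis k 1"

abbreviation law :: "(real ^ 'n) measure" where
  "law \<equiv> spherical_law \<rho>"

abbreviation a :: "real ^ 'n" where "a \<equiv> sgn (dir i)"
abbreviation e :: "real ^ 'n" where "e \<equiv> sgn (dir j)"

lemma R_dir: "R *v dir k = axis k 1"
  by (simp add: dir_def matrix_vector_mul_assoc R_inverse)

lemma dir_nonzero: "dir k \<noteq> 0"
proof
  assume "dir k = 0"
  then have "axis k (1::real) = 0" using R_dir[of k] by simp
  then show False by (simp add: axis_eq_0_iff)
qed

lemma dir_orthogonal: "dir i \<bullet> dir j = 0"
  using orthogonal by (simp add: dir_def)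

lemma norm_a: "norm a = 1" and norm_e: "norm e = 1" and e_a: "e \<bullet> a = 0"
  using dir_orthogonal dir_nonzero by (simp_all add: norm_sgn sgn_div_norm inner_commute)

lemma point_dir: "point (z + t *\<^sub>R dir k) = point z + t *\<^sub>R axis k 1"
  by (simp add: point_def matrix_vector_right_distrib R_dir scaleR_matrix_vector_assoc[symmetric] matrix_vector_mult_scaleR)

lemma shift_sgn: "(\<And>z t. F (z + t *\<^sub>R dir k) = F z) \<Longrightarrow> F (z + t *\<^sub>R sgn (dir k)) = F z"
  by (simp add: sgn_div_norm)

lemma shift_dir:
  assumes "\<And>z t. F (z + t *\<^sub>R sgn (dir k)) = F z" shows "F (z + t *\<^sub>R dir k) = F z"
proof -
  have "t *\<^sub>R dir k = (t * norm (dir k)) *\<^sub>R sgn (dir k)"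
    using dir_nonzero[of k] by (simp add: sgn_div_norm)
  then show ?thesis using assms by simp
qed

lemma measurable_point[measurable]: "point \<in> borel_measurable borel"
  unfolding point_def[abs_def]
  by (intro borel_measurable_continuous_onI continuous_intros linear_continuous_on
      linear_conv_bounded_linear[THEN iffD1] matrix_vector_mul_linear)

lemma AE_lborel_point:
  assumes "AE x in lborel. P x" shows "AE z in lborel. P (point z)"
proof -
  have neg: "negligible ((\<lambda>x. R' *v x) ` (+) (- \<mu>) ` {x. \<not> P x})"
    using assms
    by (intro negligible_differentiable_image_negligible negligible_translation
        linear_imp_differentiable_on matrix_vector_mul_linear)
      (simp_all add: AE_lborel_iff_negligible)
  have "z = R' *v (- \<mu> + point z)" for z
    by (simp add: point_def matrix_vector_mul_assoc R_inverse)
  then have "{z. \<not> P (point z)} \<subseteq> (\<lambda>x. R' *v x) ` (+) (- \<mu>) ` {x. \<not> P x}" by blast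
  then show ?thesis
    using negligible_subset[OF neg] by (simp add: AE_lborel_iff_negligible)
qed

lemma AE_law_point:
  assumes [measurable]: "Measurable.pred borel P" and inv: "\<And>x t. P (x + t *\<^sub>R axis i 1) = P x"
    and ae: "AE x in lborel. P x"
  shows "AE z in law. P (point z)"
proof (subst AE_spherical_law_cylinder_iff[OF norm_a])
  show "P (point (z + t *\<^sub>R a)) = P (point z)" for z t
    by (rule shift_sgn) (simp add: point_dir inv)
  show "AE z in lborel. z \<in> reach a \<longrightarrow> P (point z)"
    using AE_lborel_point[OF ae] by (auto elim: eventually_mono)
qed measurable

lemma integrable_coordinate: "integrable law (\<lambda>z. point z $ k)"
proof -
  interpret L: prob_space law by (rule prob_space_spherical_law)
  have "(\<lambda>z. point z $ k) = (\<lambda>z. \<mu> $ k + row k R \<bullet> z)"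
    by (simp add: point_def matrix_vector_mul_component row_def fun_eq_iff)
  then show ?thesis
    using integrable_inner_spherical_law[OF second_moment, of "row k R"] by simp
qed

text \<open>The reflection in the hyperplane orthogonal to \<open>dir j\<close> fixes \<open>dir i\<close> and the \<open>i\<close>-th coordinate of the
  point, so the conditional expectation takes the same value at a point and at its mirror image. The two
  points differ only in the \<open>j\<close>-th coordinate, and an increasing function with equal values at them has the
  same value at their midpoint. The midpoint is the projection of \<open>z\<close> onto the mirror, which does not change when \<open>z\<close>
  moves along \<open>dir j\<close>.\<close>
lemma increasing_cond_exp_ignores_coordinate:
  assumes neq: "i \<noteq> j"
    and u: "mono u" "u \<in> borel_measurable borel" "\<And>x t. u (x + t *\<^sub>R axis i 1) = u x"
    and arctan_tan: "AE z in law. arctan (tan (u (point z))) = u (point z)"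
    and CE: "cylinder_cond_exp law a (\<lambda>z. h (point z $ i)) (\<lambda>z. tan (u (point z)))"
  obtains \<Gamma> where "\<Gamma> \<in> borel_measurable borel"
    "\<And>z t. \<Gamma> (z + t *\<^sub>R a) = \<Gamma> z" "\<And>z t. \<Gamma> (z + t *\<^sub>R e) = \<Gamma> z"
    "AE z in law. tan (u (point z)) = \<Gamma> z"
proof -
  note [measurable] = u(2)
  \<comment> \<open>\<open>m z\<close> is the orthogonal projection of \<open>z\<close> onto the mirror, halfway between \<open>z\<close> and its mirror image.\<close>
  define \<beta> where "\<beta> z = (dir j \<bullet> z) / (dir j \<bullet> dir j)" for z
  define m where "m z = z - \<beta> z *\<^sub>R dir j" for z
  have mirror: "mirror (dir j) z = z + (- 2 * \<beta> z) *\<^sub>R dir j" for z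
    by (simp add: mirror_def \<beta>_def)
  have pm: "point (mirror (dir j) z) = point z + (- 2 * \<beta> z) *\<^sub>R axis j 1"
    and pc: "point (m z) = point z + (- \<beta> z) *\<^sub>R axis j 1" for z
    unfolding mirror m_def using point_dir[of z "- 2 * \<beta> z" j] point_dir[of z "- \<beta> z" j] by simp_all
  have m_j: "m (z + t *\<^sub>R dir j) = m z" for z t
    using dir_nonzero[of j]
    by (simp add: m_def \<beta>_def inner_add_right add_divide_distrib scaleR_add_left)
  have m_i: "m (z + t *\<^sub>R dir i) = m z + t *\<^sub>R dir i" for z t
    using dir_orthogonal by (simp add: m_def \<beta>_def inner_add_right inner_commute)
  define \<Gamma> where "\<Gamma> z = tan (u (point (m z)))" for z
  have [measurable]: "m \<in> borel_measurable borel" unfolding m_def \<beta>_def by measurable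
  have "\<Gamma> \<in> borel_measurable borel"
    unfolding \<Gamma>_def tan_def by measurable
  moreover have "\<Gamma> (z + t *\<^sub>R a) = \<Gamma> z" for z t
    by (rule shift_sgn) (simp add: \<Gamma>_def m_i point_dir u)
  moreover have "\<Gamma> (z + t *\<^sub>R e) = \<Gamma> z" for z t
    by (rule shift_sgn) (simp add: \<Gamma>_def m_j)
  moreover have "AE z in law. tan (u (point z)) = \<Gamma> z"
  proof -
    have "dir j \<bullet> a = 0" using dir_orthogonal by (simp add: sgn_div_norm inner_commute)
    moreover have "h (point (mirror (dir j) z) $ i) = h (point z $ i)" for z
      using neq by (simp add: pm axis_def)
    ultimately have "AE z in law. tan (u (point (mirror (dir j) z))) = tan (u (point z))"
      using cylinder_cond_exp_unique[OF sets_spherical_law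
          cylinder_cond_exp_mirror[OF sets_spherical_law spherical_law_mirror _ _ CE] CE]
      by blast
    with arctan_tan AE_spherical_law_mirror[OF arctan_tan, of "dir j"]
    show ?thesis
    proof eventually_elim
      case (elim z)
      then have same: "u (point (mirror (dir j) z)) = u (point z)" by simp
      have "u (point (m z)) = u (point z)"
      proof (cases "0 \<le> \<beta> z")
        case True
        have "point (mirror (dir j) z) \<le> point (m z)" "point (m z) \<le> point z"
          using True by (simp_all add: pm pc less_eq_vec_def axis_def)
        then show ?thesis using monoD[OF u(1)] same by (intro antisym) metis+
      next
        case False
        have "point (m z) \<le> point (mirror (dir j) z)" "point z \<le> point (m z)"
          using False by (simp_all add: pm pc less_eq_vec_def axis_def)
        then show ?thesis using monoD[OF u(1)] same by (intro antisym) metis+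
      qed
      then show ?case by (simp add: \<Gamma>_def)
    qed
  qed
  ultimately show thesis by (rule that)
qed

text \<open>Write \<open>X\<^sub>i = L + \<epsilon>\<close>, where \<open>\<epsilon>\<close> is a multiple of \<open>dir i \<bullet> Z\<close> and the regression function \<open>L\<close> depends on
  neither \<open>X\<^sub>i\<close> nor \<open>X\<^sub>j\<close>. The addition theorem expresses \<open>cos \<epsilon>\<close> through the cosine and sine of \<open>X\<^sub>i\<close>, so its
  conditional expectation \<open>\<Psi>\<close> inherits the independence of \<open>X\<^sub>j\<close>. It is also invariant under all
  reflections that fix \<open>dir i\<close>, and therefore constant.\<close>
lemma cos_product:
  assumes CE: "\<And>h. mono h \<Longrightarrow> integrable law (\<lambda>z. h (point z $ i)) \<Longrightarrow>
      \<exists>\<Phi> \<Gamma>. cylinder_cond_exp law a (\<lambda>z. h (point z $ i)) \<Phi> \<and> \<Gamma> \<in> borel_measurable borel \<and>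
        (\<forall>z t. \<Gamma> (z + t *\<^sub>R a) = \<Gamma> z) \<and> (\<forall>z t. \<Gamma> (z + t *\<^sub>R e) = \<Gamma> z) \<and> (AE z in law. \<Phi> z = \<Gamma> z)"
    and s: "0 \<le> s"
  shows "(LINT z|law. cos (s * (dir i \<bullet> z)) * cos (q * (dir j \<bullet> z)))
     = (LINT z|law. cos (s * (dir i \<bullet> z))) * (LINT z|law. cos (q * (dir j \<bullet> z)))"
proof -
  interpret L: prob_space law by (rule prob_space_spherical_law)
  note sl = sets_spherical_law
  define n where "n = dir i \<bullet> dir i"
  have n: "0 < n" using dir_nonzero by (simp add: n_def)
  \<comment> \<open>Since \<open>\<epsilon> = (dir i \<bullet> z) / n\<close>, the frequency \<open>\<sigma>\<close> makes \<open>\<sigma> \<epsilon> = s (dir i \<bullet> z)\<close>.\<close>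
  define \<sigma> where "\<sigma> = s * n"
  have \<sigma>: "0 \<le> \<sigma>" using s n by (simp add: \<sigma>_def)
  define L where "L z = point z $ i - (dir i \<bullet> z) / n" for z
  have [measurable]: "L \<in> borel_measurable borel" unfolding L_def by measurable
  have L_i: "L (z + t *\<^sub>R dir i) = L z" and L_j: "L (z + t *\<^sub>R dir j) = L z" if "i \<noteq> j" for z t
    using n dir_orthogonal that
    by (simp_all add: L_def point_dir inner_add_right add_divide_distrib axis_def flip: n_def)
  have neq: "i \<noteq> j" using dir_orthogonal dir_nonzero[of i] by auto
  have int: "integrable law (\<lambda>z. \<sigma> * (point z $ i))"
    using integrable_coordinate by simp
  have bdd: "integrable law (\<lambda>z. F z)" if [measurable]: "F \<in> borel_measurable borel" and "\<And>z. \<bar>F z\<bar> \<le> 1" for F :: "_ \<Rightarrow> real"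
    using that by (intro L.integrable_const_bound[of _ 1]) auto
  have "mono (\<lambda>y. \<sigma> * y)" using \<sigma> by (auto intro!: monoI mult_left_mono)
  from CE[OF this int] obtain \<Phi>0 \<Gamma>0 where
    0: "cylinder_cond_exp law a (\<lambda>z. \<sigma> * (point z $ i)) \<Phi>0" "\<Gamma>0 \<in> borel_measurable borel"
      "\<And>z t. \<Gamma>0 (z + t *\<^sub>R a) = \<Gamma>0 z" "\<And>z t. \<Gamma>0 (z + t *\<^sub>R e) = \<Gamma>0 z" "AE z in law. \<Phi>0 z = \<Gamma>0 z"
    by blast
  have "integrable law (\<lambda>z. \<sigma> * (point z $ i) + cos (\<sigma> * (point z $ i)))"
    by (intro Bochner_Integration.integrable_add int bdd) auto
  from CE[OF mono_plus_cos[OF \<sigma>] this] obtain \<Phi>1 \<Gamma>1 where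
    1: "cylinder_cond_exp law a (\<lambda>z. \<sigma> * (point z $ i) + cos (\<sigma> * (point z $ i))) \<Phi>1" "\<Gamma>1 \<in> borel_measurable borel"
      "\<And>z t. \<Gamma>1 (z + t *\<^sub>R a) = \<Gamma>1 z" "\<And>z t. \<Gamma>1 (z + t *\<^sub>R e) = \<Gamma>1 z" "AE z in law. \<Phi>1 z = \<Gamma>1 z"
    by blast
  have "integrable law (\<lambda>z. \<sigma> * (point z $ i) + sin (\<sigma> * (point z $ i)))"
    by (intro Bochner_Integration.integrable_add int bdd) auto
  from CE[OF mono_plus_sin[OF \<sigma>] this] obtain \<Phi>2 \<Gamma>2 where
    2: "cylinder_cond_exp law a (\<lambda>z. \<sigma> * (point z $ i) + sin (\<sigma> * (point z $ i))) \<Phi>2" "\<Gamma>2 \<in> borel_measurable borel"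
      "\<And>z t. \<Gamma>2 (z + t *\<^sub>R a) = \<Gamma>2 z" "\<And>z t. \<Gamma>2 (z + t *\<^sub>R e) = \<Gamma>2 z" "AE z in law. \<Phi>2 z = \<Gamma>2 z"
    by blast
  define \<Psi> where "\<Psi> z = cos (\<sigma> * L z) * (\<Phi>1 z - \<Phi>0 z) + sin (\<sigma> * L z) * (\<Phi>2 z - \<Phi>0 z)" for z
  define \<Gamma> where "\<Gamma> z = cos (\<sigma> * L z) * (\<Gamma>1 z - \<Gamma>0 z) + sin (\<sigma> * L z) * (\<Gamma>2 z - \<Gamma>0 z)" for z
  have L_a: "L (z + t *\<^sub>R a) = L z" and L_e: "L (z + t *\<^sub>R e) = L z" for z t
    by (rule shift_sgn, simp add: L_i L_j neq)+
  have cos_eq: "cos (\<sigma> * L z) * cos (\<sigma> * (point z $ i)) + sin (\<sigma> * L z) * sin (\<sigma> * (point z $ i)) = cos (s * (dir i \<bullet> z))" for z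
  proof -
    have "\<sigma> * (point z $ i) - \<sigma> * L z = s * (dir i \<bullet> z)"
      using n by (simp add: L_def \<sigma>_def right_diff_distrib)
    then show ?thesis using cos_diff[of "\<sigma> * (point z $ i)" "\<sigma> * L z"] by (simp add: mult.commute)
  qed
  have "cylinder_cond_exp law a (\<lambda>z. cos (\<sigma> * L z) * cos (\<sigma> * (point z $ i))) (\<lambda>z. cos (\<sigma> * L z) * (\<Phi>1 z - \<Phi>0 z))"
    using cylinder_cond_exp_mult[OF sl cylinder_cond_exp_diff[OF sl 1(1) 0(1)], of "\<lambda>z. cos (\<sigma> * L z)"]
    by (simp add: L_a)
  moreover have "cylinder_cond_exp law a (\<lambda>z. sin (\<sigma> * L z) * sin (\<sigma> * (point z $ i))) (\<lambda>z. sin (\<sigma> * L z) * (\<Phi>2 z - \<Phi>0 z))"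
    using cylinder_cond_exp_mult[OF sl cylinder_cond_exp_diff[OF sl 2(1) 0(1)], of "\<lambda>z. sin (\<sigma> * L z)"]
    by (simp add: L_a)
  ultimately have \<Psi>: "cylinder_cond_exp law a (\<lambda>z. cos (s * (dir i \<bullet> z))) \<Psi>"
    using cylinder_cond_exp_add[OF sl] unfolding \<Psi>_def cos_eq[symmetric] by blast
  have "\<exists>c. AE z in law. \<Psi> z = c"
  proof (rule constant_if_invariant_direction[OF norm_a norm_e e_a])
    show "\<Psi> \<in> borel_measurable borel" "\<Psi> (z + t *\<^sub>R a) = \<Psi> z" for z t
      using \<Psi> by (auto simp: cylinder_cond_exp_def)
    show "\<Gamma> \<in> borel_measurable borel" unfolding \<Gamma>_def using 0(2) 1(2) 2(2) by measurable
    show "\<Gamma> (z + t *\<^sub>R a) = \<Gamma> z" for z t by (simp add: \<Gamma>_def L_a 0 1 2)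
    show "\<Gamma> (z + t *\<^sub>R e) = \<Gamma> z" for z t by (simp add: \<Gamma>_def L_e 0 1 2)
    show "AE z in law. \<Psi> z = \<Gamma> z"
      using 0(5) 1(5) 2(5) by eventually_elim (simp add: \<Psi>_def \<Gamma>_def)
    fix v :: "real ^ 'n" assume v: "v \<bullet> a = 0"
    then have "v \<bullet> dir i = 0" using dir_nonzero[of i] by (simp add: sgn_div_norm)
    then have "dir i \<bullet> mirror v z = dir i \<bullet> z" for z
      using inner_mirror[of v "dir i" z] by (simp add: mirror_orthogonal)
    then show "AE z in law. \<Psi> (mirror v z) = \<Psi> z"
      using cylinder_cond_exp_unique[OF sl cylinder_cond_exp_mirror[OF sl spherical_law_mirror v _ \<Psi>] \<Psi>]
      by simp
  qed
  then obtain c where c: "AE z in law. \<Psi> z = c" ..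
  have \<Psi>_m [measurable]: "\<Psi> \<in> borel_measurable borel" using \<Psi> by (auto simp: cylinder_cond_exp_def)
  have factor: "(LINT z|law. cos (s * (dir i \<bullet> z)) * k z) = c * (LINT z|law. k z)"
    if [measurable]: "k \<in> borel_measurable borel" and "\<And>z. \<bar>k z\<bar> \<le> 1" "\<And>z t. k (z + t *\<^sub>R a) = k z" for k
  proof -
    have "(LINT z|law. cos (s * (dir i \<bullet> z)) * k z) = (LINT z|law. \<Psi> z * k z)"
      using \<Psi> that unfolding cylinder_cond_exp_def by blast
    also have "\<dots> = (LINT z|law. c * k z)"
      using c by (intro integral_cong_AE) (auto elim: eventually_mono)
    finally show ?thesis by simp
  qed
  have "c = (LINT z|law. cos (s * (dir i \<bullet> z)))"
    using factor[of "\<lambda>_. 1"] L.prob_space by simp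
  moreover have "cos (q * (dir j \<bullet> (z + t *\<^sub>R a))) = cos (q * (dir j \<bullet> z))" for z t
    by (rule shift_sgn) (use dir_orthogonal in \<open>simp add: inner_add_right inner_commute\<close>)
  ultimately show ?thesis
    using factor[of "\<lambda>z. cos (q * (dir j \<bullet> z))"] by simp
qed

text \<open>Conditional increasingness supplies a monotone version \<open>G\<close> of the conditional expectation, which need not
  be measurable. It lies between its two regularisations; these are Borel and agree
  at almost every value of \<open>X\<close>, since the law of \<open>X\<close> charges no Lebesgue null cylinder. So the lower
  regularisation \<open>u\<close> is a Borel version that is still monotone. The arctangent in \<open>G\<close> is undone by \<open>tan\<close>.\<close>
lemma cond_exp_from_conditionally_increasing:
  fixes Y :: "'a \<Rightarrow> real ^ 'n"
  assumes "prob_space M" and f: "\<And>i. strict_mono (f i)"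
    and [measurable]: "Y \<in> borel_measurable M" "coordinatewise f Y \<in> borel_measurable M"
    and CI: "conditionally_increasing M Y"
    and distr: "distr M borel (coordinatewise f Y) = distr law borel point"
    and h: "mono h" "integrable law (\<lambda>z. h (point z $ i))"
  shows "\<exists>\<Phi> \<Gamma>. cylinder_cond_exp law a (\<lambda>z. h (point z $ i)) \<Phi> \<and> \<Gamma> \<in> borel_measurable borel \<and>
        (\<forall>z t. \<Gamma> (z + t *\<^sub>R a) = \<Gamma> z) \<and> (\<forall>z t. \<Gamma> (z + t *\<^sub>R e) = \<Gamma> z) \<and> (AE z in law. \<Phi> z = \<Gamma> z)"
proof -
  interpret M: prob_space M by fact
  define X where "X = coordinatewise f Y"
  have [measurable]: "X \<in> borel_measurable M" by (simp add: X_def)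
  have neq: "i \<noteq> j" using dir_orthogonal dir_nonzero[of i] by auto
  have transfer: "(LINT z|law. F (point z)) = (LINT \<omega>|M. F (X \<omega>))"
    "integrable law (\<lambda>z. F (point z)) \<longleftrightarrow> integrable M (\<lambda>\<omega>. F (X \<omega>))"
    if [measurable]: "F \<in> borel_measurable borel" for F :: "real ^ 'n \<Rightarrow> real"
    using integral_distr[of point law borel F] integral_distr[of X M borel F]
      integrable_distr_eq[of point law borel F] integrable_distr_eq[of X M borel F] distr
    by (simp_all add: X_def)
  have transfer_AE: "(AE z in law. P (point z)) \<longleftrightarrow> (AE \<omega> in M. P (X \<omega>))"
    if [measurable]: "Measurable.pred borel P" for P
  proof -
    have "(AE z in law. P (point z)) \<longleftrightarrow> (AE x in distr law borel point. P x)"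
      by (subst AE_distr_iff) auto
    also have "\<dots> \<longleftrightarrow> (AE x in distr M borel X. P x)"
      by (simp only: distr X_def)
    also have "\<dots> \<longleftrightarrow> (AE \<omega> in M. P (X \<omega>))"
      by (subst AE_distr_iff) auto
    finally show ?thesis .
  qed
  have [measurable]: "h \<in> borel_measurable borel" using h(1) by (rule borel_measurable_mono)
  have hM: "integrable M (\<lambda>\<omega>. h (coordinatewise f Y \<omega> $ i))"
    using h(2) transfer(2)[of "\<lambda>x. h (x $ i)"] by (simp add: X_def)
  let ?ce = "real_cond_exp M (sigma_of_subvector M Y (UNIV - {i})) (\<lambda>\<omega>. h (coordinatewise f Y \<omega> $ i))"
  obtain G :: "real ^ 'n \<Rightarrow> real" where G: "mono G" "\<And>x. \<bar>G x\<bar> \<le> 2" "\<And>x t. G (x + t *\<^sub>R axis i 1) = G x"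
    and ce_G: "AE \<omega> in M. arctan (?ce \<omega>) = G (X \<omega>)"
    using cond_exp_increasing_version[of f M Y h i, OF f CI h(1) hM] unfolding X_def by blast
  define u where "u = sup_below G"
  have u: "mono u" "u \<in> borel_measurable borel" "\<And>x t. u (x + t *\<^sub>R axis i 1) = u x"
    unfolding u_def by (rule mono_sup_below measurable_sup_below sup_below_shift; fact G)+
  note [measurable] = u(2) measurable_inf_above[OF G(1,2)]
  have "Measurable.pred borel (\<lambda>x. u x = inf_above G x)" by measurable
  then have "AE z in law. u (point z) = inf_above G (point z)"
    using AE_law_point[of "\<lambda>x. u x = inf_above G x"] AE_sup_below_eq_inf_above[OF G(1,2)]
      inf_above_shift[OF G(1,2) G(3)] u(3) by (simp add: u_def)
  then have "AE \<omega> in M. u (X \<omega>) = inf_above G (X \<omega>)"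
    using transfer_AE[of "\<lambda>x. u x = inf_above G x"] by simp
  with ce_G have ce_u: "AE \<omega> in M. arctan (?ce \<omega>) = u (X \<omega>)"
  proof eventually_elim
    case (elim \<omega>)
    then show ?case
      using sup_below_le[OF G(1,2), of "X \<omega>"] le_inf_above[OF G(1,2), of "X \<omega>"] by (simp add: u_def)
  qed
  then have "AE \<omega> in M. arctan (tan (u (X \<omega>))) = u (X \<omega>)"
    by eventually_elim (metis tan_arctan)
  then have arctan_tan: "AE z in law. arctan (tan (u (point z))) = u (point z)"
    using transfer_AE[of "\<lambda>x. arctan (tan (u x)) = u x"] by (simp add: tan_def)
  have tan_m [measurable]: "(\<lambda>x. tan (u x)) \<in> borel_measurable borel" unfolding tan_def by measurable
  from ce_u have ce_tan: "AE \<omega> in M. ?ce \<omega> = tan (u (X \<omega>))"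
    by eventually_elim (metis tan_arctan)
  interpret CE: finite_measure_subalgebra M "sigma_of_subvector M Y (UNIV - {i})"
    by unfold_locales (rule subalgebra_sigma_of_subvector, fact)
  have ce_int: "integrable M ?ce" using hM by (rule CE.real_cond_exp_int)
  have "cylinder_cond_exp law a (\<lambda>z. h (point z $ i)) (\<lambda>z. tan (u (point z)))"
    unfolding cylinder_cond_exp_def
  proof (intro conjI allI impI)
    have "integrable M (\<lambda>\<omega>. tan (u (X \<omega>)))"
      by (rule integrable_cong_AE_imp[OF ce_int _ ce_tan]) measurable
    then show "integrable law (\<lambda>z. tan (u (point z)))"
      using transfer(2)[OF tan_m] by simp
    show "(\<lambda>z. tan (u (point z))) \<in> borel_measurable borel" by measurable
    show "tan (u (point (z + t *\<^sub>R a))) = tan (u (point z))" for z t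
      by (rule shift_sgn) (simp add: point_dir u)
    fix k :: "real ^ 'n \<Rightarrow> real" and B
    assume [measurable]: "k \<in> borel_measurable borel" and k: "\<forall>z. \<bar>k z\<bar> \<le> B" "\<forall>z t. k (z + t *\<^sub>R a) = k z"
    define k' where "k' x = k (R' *v (x - \<mu>))" for x
    have k'_point: "k' (point z) = k z" for z
      by (simp add: k'_def point_def matrix_vector_mul_assoc R_inverse)
    have k'_inv: "k' (x + t *\<^sub>R axis i 1) = k' x" for x t
    proof -
      have "R' *v (x + t *\<^sub>R axis i 1 - \<mu>) = R' *v (x - \<mu>) + t *\<^sub>R dir i"
        by (simp add: dir_def matrix_vector_mult_diff_distrib matrix_vector_right_distrib matrix_vector_mult_scaleR)
      then show ?thesis using shift_dir[of k i] k(2) by (simp add: k'_def)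
    qed
    have "(\<lambda>x. R' *v (x - \<mu>)) \<in> borel_measurable borel"
      by (intro borel_measurable_continuous_onI matrix_vector_mult_linear_continuous_on continuous_intros
          continuous_on_compose2[OF linear_continuous_on[OF matrix_vector_mul_bounded_linear]]) auto
    then have k'_m [measurable]: "k' \<in> borel_measurable borel" unfolding k'_def by measurable
    have k'_le: "\<bar>k' x\<bar> \<le> B" for x using k(1) by (simp add: k'_def)
    have "(LINT z|law. h (point z $ i) * k z) = (LINT \<omega>|M. h (X \<omega> $ i) * k' (X \<omega>))"
      using transfer(1)[of "\<lambda>x. h (x $ i) * k' x"] by (simp add: k'_point)
    also have "\<dots> = (LINT \<omega>|M. ?ce \<omega> * k' (X \<omega>))"
      unfolding X_def
      by (rule integral_real_cond_exp_subvector[where B=B, OF \<open>prob_space M\<close> f _ _ hM])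
        (auto intro: k'_m k'_le k'_inv)
    also have "\<dots> = (LINT \<omega>|M. tan (u (X \<omega>)) * k' (X \<omega>))"
      using ce_tan ce_int by (intro integral_cong_AE) (auto elim: eventually_mono)
    also have "\<dots> = (LINT z|law. tan (u (point z)) * k z)"
      using transfer(1)[of "\<lambda>x. tan (u x) * k' x"] by (simp add: k'_point)
    finally show "(LINT z|law. h (point z $ i) * k z) = (LINT z|law. tan (u (point z)) * k z)" .
  qed (fact h(2))
  note ce = this
  obtain \<Gamma> where "\<Gamma> \<in> borel_measurable borel" "\<And>z t. \<Gamma> (z + t *\<^sub>R a) = \<Gamma> z"
    "\<And>z t. \<Gamma> (z + t *\<^sub>R e) = \<Gamma> z" "AE z in law. tan (u (point z)) = \<Gamma> z"
    using increasing_cond_exp_ignores_coordinate[OF neq u arctan_tan ce] by blast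
  with ce show ?thesis by (intro exI[of _ "\<lambda>z. tan (u (point z))"] exI[of _ \<Gamma>]) simp
qed

text \<open>Adding the values of \<open>\<phi>\<close> at \<open>s d\<^sub>i + t d\<^sub>j\<close> and \<open>s d\<^sub>i - t d\<^sub>j\<close>, two vectors of the same length
  because \<open>d\<^sub>i\<close> and \<open>d\<^sub>j\<close> are orthogonal, produces the product of cosines that factorises.\<close>
lemma radial_char_exponential:
  assumes CE: "\<And>h. mono h \<Longrightarrow> integrable law (\<lambda>z. h (point z $ i)) \<Longrightarrow>
      \<exists>\<Phi> \<Gamma>. cylinder_cond_exp law a (\<lambda>z. h (point z $ i)) \<Phi> \<and> \<Gamma> \<in> borel_measurable borel \<and>
        (\<forall>z t. \<Gamma> (z + t *\<^sub>R a) = \<Gamma> z) \<and> (\<forall>z t. \<Gamma> (z + t *\<^sub>R e) = \<Gamma> z) \<and> (AE z in law. \<Phi> z = \<Gamma> z)"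
    and \<phi>: "\<And>w. (LINT z|law. cos (w \<bullet> z)) = \<phi> (w \<bullet> w)"
  obtains c where "0 \<le> c" "\<And>p. 0 \<le> p \<Longrightarrow> \<phi> p = exp (- c * p)"
proof (rule multiplicative_bounded_exp[of \<phi>])
  interpret L: prob_space law by (rule prob_space_spherical_law)
  have bdd: "integrable law F" if [measurable]: "F \<in> borel_measurable borel" and "\<And>z. \<bar>F z\<bar> \<le> 1" for F :: "_ \<Rightarrow> real"
    using that by (intro L.integrable_const_bound[of _ 1]) auto
  have C: "\<phi> p = (LINT z|law. cos (sqrt p * (e \<bullet> z)))" if "0 \<le> p" for p
    using \<phi>[of "sqrt p *\<^sub>R e"] norm_e that by (simp add: dot_square_norm)
  show "\<bar>\<phi> p\<bar> \<le> 1" if "0 \<le> p" for p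
  proof -
    have "\<bar>LINT z|law. cos (sqrt p * (e \<bullet> z))\<bar> \<le> (LINT z|law. \<bar>cos (sqrt p * (e \<bullet> z))\<bar>)"
      by (rule integral_abs_bound)
    also have "\<dots> \<le> (LINT z|law. 1)"
      by (intro integral_mono bdd) auto
    finally show ?thesis using C[OF that] L.prob_space by simp
  qed
  show "(\<lambda>n. \<phi> (p / 2 ^ n)) \<longlonglongrightarrow> 1" if p: "0 \<le> p" for p
  proof -
    have "(\<lambda>n. LINT z|law. cos (sqrt (p / 2 ^ n) * (e \<bullet> z))) \<longlonglongrightarrow> (LINT z|law. 1)"
    proof (rule integral_dominated_convergence[where w="\<lambda>_. 1"])
      show "AE z in law. (\<lambda>n. cos (sqrt (p / 2 ^ n) * (e \<bullet> z))) \<longlonglongrightarrow> 1"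
      proof (rule AE_I2)
        fix z :: "real ^ 'n"
        have "(\<lambda>n. p * (1 / 2) ^ n) \<longlonglongrightarrow> p * 0"
          by (intro tendsto_mult tendsto_const LIMSEQ_realpow_zero) auto
        then have "(\<lambda>n. cos (sqrt (p * (1 / 2) ^ n) * (e \<bullet> z))) \<longlonglongrightarrow> cos (sqrt (p * 0) * (e \<bullet> z))"
          by (rule tendsto_cos[OF tendsto_mult[OF tendsto_real_sqrt tendsto_const]])
        then show "(\<lambda>n. cos (sqrt (p / 2 ^ n) * (e \<bullet> z))) \<longlonglongrightarrow> 1"
          by (simp add: power_one_over)
      qed
    qed auto
    then show ?thesis using C p L.prob_space by simp
  qed
  show "\<phi> (p + q) = \<phi> p * \<phi> q" if pq: "0 \<le> p" "0 \<le> q" for p q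
  proof -
    define s where "s = sqrt p / norm (dir i)"
    define t where "t = sqrt q / norm (dir j)"
    have s: "s * s * (dir i \<bullet> dir i) = p" and t: "t * t * (dir j \<bullet> dir j) = q"
      using pq dir_nonzero by (simp_all add: s_def t_def dot_square_norm power2_eq_square)
    have s0: "0 \<le> s" using pq by (simp add: s_def)
    have sq: "(s *\<^sub>R dir i + t *\<^sub>R dir j) \<bullet> (s *\<^sub>R dir i + t *\<^sub>R dir j) = p + q"
      "(s *\<^sub>R dir i - t *\<^sub>R dir j) \<bullet> (s *\<^sub>R dir i - t *\<^sub>R dir j) = p + q"
      using s t dir_orthogonal by (simp_all add: inner_add_left inner_add_right inner_diff_left inner_diff_right inner_commute)
    have "2 * (LINT z|law. cos (s * (dir i \<bullet> z)) * cos (t * (dir j \<bullet> z)))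
        = (LINT z|law. cos ((s *\<^sub>R dir i + t *\<^sub>R dir j) \<bullet> z) + cos ((s *\<^sub>R dir i - t *\<^sub>R dir j) \<bullet> z))"
      by (subst integral_mult_right_zero[symmetric])
        (simp add: inner_add_left inner_diff_left cos_add cos_diff)
    also have "\<dots> = 2 * \<phi> (p + q)"
      by (subst Bochner_Integration.integral_add) (auto intro!: bdd simp: \<phi> sq)
    finally have "\<phi> (p + q) = (LINT z|law. cos (s * (dir i \<bullet> z))) * (LINT z|law. cos (t * (dir j \<bullet> z)))"
      using cos_product[OF CE s0, of t] by simp
    also have "\<dots> = \<phi> p * \<phi> q"
      using \<phi>[of "s *\<^sub>R dir i"] \<phi>[of "t *\<^sub>R dir j"] s t by (simp add: mult.assoc)
    finally show ?thesis .
  qed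
  fix c assume "0 \<le> c" "\<And>p. 0 \<le> p \<Longrightarrow> \<phi> p = exp (- c * p)"
  then show thesis by (rule that)
qed

end

section \<open>Elliptical and transelliptical vectors\<close>

lemma distr_pair_uniform_sphere:
  fixes R :: "real ^ 'n ^ 'n"
  assumes "prob_space \<rho>" and [measurable_cong]: "sets \<rho> = sets borel"
  shows "distr (\<rho> \<Otimes>\<^sub>M uniform_sphere) borel (\<lambda>(r, u). \<mu> + r *\<^sub>R (R *v u))
    = distr (spherical_law \<rho>) borel (\<lambda>z. \<mu> + R *v z)"
proof -
  let ?U = "uniform_measure lborel (ball (0::real ^ 'n) 1)"
  interpret prob_space \<rho> by fact
  interpret U: prob_space ?U by (rule prob_space_uniform_ball)
  interpret S: prob_space "distr ?U borel sgn" by (rule U.prob_space_distr) simp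
  have [measurable]: "(*v) R \<in> borel_measurable borel"
    by (intro borel_measurable_continuous_onI linear_continuous_on matrix_vector_mul_bounded_linear)
  have "\<rho> \<Otimes>\<^sub>M uniform_sphere = distr \<rho> \<rho> (\<lambda>r. r) \<Otimes>\<^sub>M distr ?U borel sgn"
    by (simp add: uniform_sphere_def distr_id2)
  also have "\<dots> = distr (\<rho> \<Otimes>\<^sub>M ?U) (\<rho> \<Otimes>\<^sub>M borel) (\<lambda>(r, b). (r, sgn b))"
    by (rule pair_measure_distr) (auto intro: S.sigma_finite_measure_axioms)
  finally have P: "\<rho> \<Otimes>\<^sub>M uniform_sphere = distr (\<rho> \<Otimes>\<^sub>M ?U) (\<rho> \<Otimes>\<^sub>M borel) (\<lambda>(r, b). (r, sgn b))" .
  show ?thesis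
    unfolding P spherical_law_def
    by (subst (1 2) distr_distr)
      (auto simp: comp_def case_prod_unfold matrix_vector_mult_scaleR intro!: distr_cong)
qed

text \<open>The strictly increasing transformation is injective, so an atom of \<open>f(Y)\<close> would be an atom of \<open>Y\<close>,
  which has a density.\<close>
lemma AE_coordinatewise_neq:
  assumes f: "\<And>i. strict_mono (f i)" and Y: "distributed M lborel Y p"
  shows "AE \<omega> in M. coordinatewise f Y \<omega> \<noteq> (x :: real ^ 'n)"
proof (cases "\<exists>\<omega>0. coordinatewise f Y \<omega>0 = x")
  case True
  then obtain \<omega>0 where \<omega>0: "coordinatewise f Y \<omega>0 = x" ..
  have "AE y in density lborel p. y \<noteq> Y \<omega>0"
    using distributed_borel_measurable[OF Y] AE_lborel_singleton[of "Y \<omega>0"]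
    by (subst AE_density) (auto elim: eventually_mono)
  then have "AE y in distr M lborel Y. y \<noteq> Y \<omega>0"
    by (simp only: distributed_distr_eq_density[OF Y])
  then have "AE \<omega> in M. Y \<omega> \<noteq> Y \<omega>0"
    by (rule AE_distrD[OF distributed_measurable[OF Y]])
  then show ?thesis
  proof eventually_elim
    case (elim \<omega>)
    show ?case
    proof
      assume "coordinatewise f Y \<omega> = x"
      then have "f k (Y \<omega> $ k) = f k (Y \<omega>0 $ k)" for k
        using \<omega>0 by (auto simp: coordinatewise_def vec_eq_iff)
      then have "Y \<omega> = Y \<omega>0"
        using strict_mono_eq[OF f] by (auto simp: vec_eq_iff)
      then show False using elim by simp
    qed
  qed
qed simp

text \<open>If the radius vanished with positive probability, the centre \<open>\<mu>\<close> would be an atom.\<close>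
lemma positive_radius_if_no_atom:
  fixes R :: "real ^ 'n ^ 'n"
  assumes "prob_space \<rho>" and s: "sets \<rho> = sets borel" and nonneg: "AE r in \<rho>. 0 \<le> r"
    and atom: "AE x in distr (spherical_law \<rho>) borel (\<lambda>z. \<mu> + R *v z). x \<noteq> \<mu>"
  shows "positive_radius \<rho>"
proof -
  let ?U = "uniform_measure lborel (ball (0::real ^ 'n) 1)"
  note [measurable_cong] = s
  interpret prob_space \<rho> by fact
  interpret U: prob_space ?U by (rule prob_space_uniform_ball)
  interpret P: pair_prob_space \<rho> ?U ..
  have [measurable]: "(*v) R \<in> borel_measurable borel"
    by (intro borel_measurable_continuous_onI linear_continuous_on matrix_vector_mul_bounded_linear)
  have "AE z in spherical_law \<rho>. \<mu> + R *v z \<noteq> \<mu>"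
    by (rule AE_distrD[OF _ atom]) (simp add: spherical_law_def)
  then have "AE x in \<rho> \<Otimes>\<^sub>M ?U. \<mu> + R *v (case x of (r, b) \<Rightarrow> r *\<^sub>R sgn b) \<noteq> \<mu>"
    unfolding spherical_law_def by (rule AE_distrD[rotated]) simp
  from P.AE_pair[OF this] have "AE r in \<rho>. AE b in ?U. R *v (r *\<^sub>R sgn b) \<noteq> 0" by simp
  then have "AE r in \<rho>. 0 < r"
    using nonneg
  proof eventually_elim
    case (elim r)
    have "r \<noteq> 0" using elim by (auto simp: U.AE_False)
    then show ?case using elim by simp
  qed
  then show ?thesis by unfold_locales (auto simp: s)
qed

lemma cos_integral_of_elliptical:
  fixes R :: "real ^ 'n ^ 'n"
  assumes "prob_space M" and [measurable]: "X \<in> borel_measurable M"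
    and sym: "transpose R = R" and sqr: "R ** R = \<Sigma>"
    and "prob_space L" and [measurable_cong]: "sets L = sets borel"
    and distr: "distr M borel X = distr L borel (\<lambda>z. \<mu> + R *v z)"
    and char: "char_vec M X t = complex_of_real (\<phi> (t \<bullet> (\<Sigma> *v t))) * iexp (\<mu> \<bullet> t)"
  shows "(LINT z|L. cos ((R *v t) \<bullet> z)) = \<phi> ((R *v t) \<bullet> (R *v t))"
proof -
  interpret L: prob_space L by fact
  have [measurable]: "(*v) R \<in> borel_measurable borel"
    by (intro borel_measurable_continuous_onI linear_continuous_on matrix_vector_mul_bounded_linear)
  have move: "x \<bullet> (R *v y) = (R *v x) \<bullet> y" for x y
    by (metis dot_lmul_matrix sym transpose_matrix_vector)
  have int: "integrable L (\<lambda>z. iexp ((R *v t) \<bullet> z))"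
    by (rule L.integrable_const_bound[of _ 1]) auto
  have "char_vec M X t = (CLINT x|distr M borel X. iexp (t \<bullet> x))"
    unfolding char_vec_def by (subst integral_distr) auto
  also have "\<dots> = (CLINT z|L. iexp (t \<bullet> (\<mu> + R *v z)))"
    unfolding distr by (subst integral_distr) auto
  also have "\<dots> = (CLINT z|L. iexp (\<mu> \<bullet> t) * iexp ((R *v t) \<bullet> z))"
    by (intro Bochner_Integration.integral_cong refl)
      (simp add: inner_add_right move inner_commute[of t \<mu>] distrib_left exp_add)
  also have "\<dots> = iexp (\<mu> \<bullet> t) * (CLINT z|L. iexp ((R *v t) \<bullet> z))"
    by (rule integral_mult_right_zero)
  finally have "(CLINT z|L. iexp ((R *v t) \<bullet> z)) = complex_of_real (\<phi> (t \<bullet> (\<Sigma> *v t)))"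
    using char by (simp add: mult.commute)
  then have "Re (CLINT z|L. iexp ((R *v t) \<bullet> z)) = \<phi> (t \<bullet> (\<Sigma> *v t))" by simp
  moreover have "t \<bullet> (\<Sigma> *v t) = (R *v t) \<bullet> (R *v t)"
    by (simp add: sqr[symmetric] matrix_vector_mul_assoc[symmetric] move)
  ultimately show ?thesis
    using int by (subst (asm) integral_Re[symmetric]) (simp_all add: Re_exp)
qed

text \<open>With \<open>R' = R K\<close> the inverse of \<open>R\<close>, the inner product of \<open>R' e\<^sub>i\<close> and \<open>R' e\<^sub>j\<close> is \<open>K\<^sub>i\<^sub>j\<close>: this is where
  the zero entry enters. The exponential form of \<open>\<phi>\<close> then reads off the covariance matrix \<open>2 c \<Sigma>\<close>.\<close>
lemma gaussian_of_transelliptical: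
  fixes M :: "'a measure" and \<mu> :: "real ^ 'n" and \<Sigma> K :: "real ^ 'n ^ 'n"
  assumes M: "prob_space M" and pd: "positive_definite \<Sigma>" and K: "K = matrix_inv \<Sigma>" "K $ i $ j = 0"
    and TE: "transelliptical_via f M Y \<mu> \<Sigma>"
    and SR: "stochastic_representation M (coordinatewise f Y) \<mu> \<Sigma>"
    and CI: "conditionally_increasing M Y"
  shows "gaussian_vector M (coordinatewise f Y)"
proof -
  let ?X = "coordinatewise f Y"
  have f: "\<And>i. strict_mono (f i)" and Y: "Y \<in> borel_measurable M" and X: "?X \<in> borel_measurable M"
    using TE by (auto simp: transelliptical_via_def elliptical_def)
  obtain \<phi> where \<phi>: "\<And>t. char_vec M ?X t = complex_of_real (\<phi> (t \<bullet> (\<Sigma> *v t))) * iexp (\<mu> \<bullet> t)"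
    using TE by (auto simp: transelliptical_via_def elliptical_def)
  obtain \<rho> R where \<rho>: "prob_space \<rho>" "sets \<rho> = sets borel" "AE r in \<rho>. 0 \<le> r" "integrable \<rho> (\<lambda>r. r\<^sup>2)"
    and R: "positive_definite R" "R ** R = \<Sigma>"
    and distr: "distr M borel ?X = distr (\<rho> \<Otimes>\<^sub>M uniform_sphere) borel (\<lambda>(r, u). \<mu> + r *\<^sub>R (R *v u))"
    using SR unfolding stochastic_representation_def by blast
  have distr': "distr M borel ?X = distr (spherical_law \<rho>) borel (\<lambda>z. \<mu> + R *v z)"
    using distr distr_pair_uniform_sphere[OF \<rho>(1,2)] by simp
  have "AE x in distr M borel ?X. x \<noteq> \<mu>"
    using AE_coordinatewise_neq[OF f] CI X by (subst AE_distr_iff) (auto simp: conditionally_increasing_def)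
  then interpret positive_radius \<rho>
    unfolding distr' by (rule positive_radius_if_no_atom[OF \<rho>(1,2,3)])
  have sym: "transpose R = R" using R(1) by (simp add: positive_definite_def)
  have move: "x \<bullet> (R *v y) = (R *v x) \<bullet> y" for x y
    by (metis dot_lmul_matrix sym transpose_matrix_vector)
  have "\<Sigma> *v x = 0 \<Longrightarrow> x = 0" for x
    using pd by (metis inner_zero_right less_irrefl positive_definite_def)
  then have "invertible \<Sigma>"
    using matrix_left_invertible_ker[of \<Sigma>] invertible_left_inverse by blast
  then have \<Sigma>K: "\<Sigma> ** K = mat 1" "K ** \<Sigma> = mat 1"
    using someI_ex[of "\<lambda>A. \<Sigma> ** A = mat 1 \<and> A ** \<Sigma> = mat 1"]
    by (auto simp: K(1) matrix_inv_def invertible_def)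
  define R' where "R' = R ** K"
  have RR': "R ** R' = mat 1" using \<Sigma>K(1) R(2) by (simp add: R'_def matrix_mul_assoc)
  then have R'R: "R' ** R = mat 1" using matrix_left_right_inverse by blast
  have orth: "(R' *v axis i 1) \<bullet> (R' *v axis j 1) = 0"
  proof -
    have "R *v (R' *v axis i 1) = axis i 1" by (simp add: matrix_vector_mul_assoc RR')
    then have "(R' *v axis i 1) \<bullet> (R' *v axis j 1) = axis i 1 \<bullet> (K *v axis j 1)"
      by (simp add: R'_def matrix_vector_mul_assoc[symmetric] move)
    then show ?thesis
      using K(2) by (simp add: inner_axis' matrix_vector_mult_basis column_def)
  qed
  interpret whitened_frame \<rho> R R' \<mu> i j
    by unfold_locales (fact RR' R'R \<rho>(4) orth)+
  have distr_point: "distr M borel ?X = distr (spherical_law \<rho>) borel point"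
    using distr' by (simp add: point_def[abs_def])
  have cos_\<phi>: "(LINT z|law. cos (w \<bullet> z)) = \<phi> (w \<bullet> w)" for w
  proof -
    have "R *v (R' *v w) = w" by (simp add: matrix_vector_mul_assoc RR')
    then show ?thesis
      using cos_integral_of_elliptical[where \<phi>=\<phi> and t="R' *v w",
          OF M X sym R(2) prob_space_spherical_law sets_spherical_law distr' \<phi>]
      by simp
  qed
  obtain c where c: "0 \<le> c" "\<And>p. 0 \<le> p \<Longrightarrow> \<phi> p = exp (- c * p)"
    using radial_char_exponential[OF cond_exp_from_conditionally_increasing[OF M f Y X CI distr_point] cos_\<phi>]
    by blast
  have quad: "0 \<le> t \<bullet> (\<Sigma> *v t)" for t
    using pd by (cases "t = 0") (auto simp: positive_definite_def intro: less_imp_le)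
  have scaled: "((2 * c) *\<^sub>R \<Sigma>) *v t = (2 * c) *\<^sub>R (\<Sigma> *v t)" for t
    by (simp add: scaleR_matrix_vector_assoc)
  show ?thesis
    unfolding gaussian_vector_def
  proof (intro conjI exI allI)
    show "?X \<in> borel_measurable M" by (rule X)
    have "transpose ((2 * c) *\<^sub>R \<Sigma>) = (2 * c) *\<^sub>R transpose \<Sigma>"
      by (simp add: transpose_def vec_eq_iff)
    then show "positive_semidefinite ((2 * c) *\<^sub>R \<Sigma>)"
      using pd quad c(1) by (simp add: positive_semidefinite_def positive_definite_def scaled)
    fix t
    have "char_vec M ?X t = exp (complex_of_real (- c * (t \<bullet> (\<Sigma> *v t)))) * iexp (\<mu> \<bullet> t)"
      by (simp only: exp_of_real \<phi>[of t] c(2)[OF quad])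
    also have "\<dots> = exp (\<i> * complex_of_real (\<mu> \<bullet> t) - complex_of_real (t \<bullet> (((2 * c) *\<^sub>R \<Sigma>) *v t)) / 2)"
      by (simp add: exp_add[symmetric] scaled)
    finally show "char_vec M ?X t = exp (\<i> * complex_of_real (\<mu> \<bullet> t) - complex_of_real (t \<bullet> (((2 * c) *\<^sub>R \<Sigma>) *v t)) / 2)" .
  qed
qed

theorem theorem4p8:
  fixes M :: "'a measure" and \<mu> :: "real ^ 'n" and \<Sigma> K :: "real ^ 'n ^ 'n"
  assumes "prob_space M"
    and "positive_definite \<Sigma>"
    and "K = matrix_inv \<Sigma>"
    and "\<exists>i j. K $ i $ j = 0"
  shows "(\<forall>X. elliptical M X \<mu> \<Sigma> \<and> stochastic_representation M X \<mu> \<Sigma> \<and>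
              conditionally_increasing M X \<longrightarrow> gaussian_vector M X) \<and>
         (\<forall>Y f X. transelliptical_via f M Y \<mu> \<Sigma> \<and> X = coordinatewise f Y \<and>
              stochastic_representation M X \<mu> \<Sigma> \<and>
              conditionally_increasing M Y \<longrightarrow> gaussian_vector M X)"
proof -
  obtain i j where "K $ i $ j = 0" using assms(4) by blast
  note gauss = gaussian_of_transelliptical[OF assms(1-3) this]
  have "gaussian_vector M X"
    if "elliptical M X \<mu> \<Sigma>" "stochastic_representation M X \<mu> \<Sigma>" "conditionally_increasing M X" for X
  proof -
    have X: "coordinatewise (\<lambda>_ y. y) X = X" by (simp add: coordinatewise_def)
    then have "transelliptical_via (\<lambda>_ y. y) M X \<mu> \<Sigma>"
      using that(1) by (simp add: transelliptical_via_def elliptical_def strict_mono_def)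
    then show ?thesis using gauss[of "\<lambda>_ y. y" X] that X by simp
  qed
  then show ?thesis using gauss by blast
qed

end
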